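(* Let $n\geq2$. 1) The subgroup of $GL(n,\mathbb R)$ that globally preserves a hyperplane of $\mathbb R^n$ is a contact Lie group which contains the group $Aff(\mathbb R^{n-1})$ of affine diffeomorphisms of $\mathbb R^{n-1}$ as a distinguished (i.e. normal) subgroup of codimension $1$. 2) Let $v$ be a non-zero vector in $\mathbb R^n$. The Lie subgroup of $GL(n,\mathbb R)$ consisting of all linear diffeomorphisms of $\mathbb R^n$ with common eigenvector $v$ is a contact Lie group.
   Context: A Lie group of dimension $2k+1$ is a contact Lie group if it carries a left invariant 1-form $\eta^+$ with $(d\eta^+)^k\wedge\eta^+\neq0$ pointwise. $GL(n,\mathbb R)$ is the group of linear diffeomorphisms of $\mathbb R^n$. A hyperplane of $\mathbb R^n$ is here a linear hyperplane. *)

theory Defs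
  imports "HOL-Analysis.Analysis" "HOL-Algebra.Coset"
begin

section \<open>Smooth maps and embedded submanifolds of a Euclidean space\<close>

primrec Ck_on ::
    "nat \<Rightarrow> 'a::real_normed_vector set \<Rightarrow> ('a \<Rightarrow> 'b::real_normed_vector) \<Rightarrow> bool" where
  "Ck_on 0 U f \<longleftrightarrow> continuous_on U f"
| "Ck_on (Suc k) U f \<longleftrightarrow> (\<forall>x\<in>U. f differentiable (at x)) \<and>
     (\<forall>v. Ck_on k U (\<lambda>x. frechet_derivative f (at x) v))"

text \<open>In finite dimension, the class \<open>C\<^sup>\<infinity>\<close> on an open set.\<close>

definition smooth_on :: "'a::real_normed_vector set \<Rightarrow> ('a \<Rightarrow> 'b::real_normed_vector) \<Rightarrow> bool" where
  "smooth_on U f \<longleftrightarrow> open U \<and> (\<forall>k. Ck_on k U f)"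

text \<open>Smoothness on an arbitrary set: existence of local smooth extensions. On an embedded
  submanifold this is smoothness in charts.\<close>

definition smooth_map_on :: "'a::euclidean_space set \<Rightarrow> ('a \<Rightarrow> 'b::euclidean_space) \<Rightarrow> bool" where
  "smooth_map_on M f \<longleftrightarrow>
     (\<forall>p\<in>M. \<exists>U g. p \<in> U \<and> smooth_on U g \<and> (\<forall>x\<in>M \<inter> U. g x = f x))"

definition smooth_submanifold :: "nat \<Rightarrow> 'a::euclidean_space set \<Rightarrow> bool" where
  "smooth_submanifold d M \<longleftrightarrow>
     (\<forall>p\<in>M. \<exists>U V \<phi> \<psi> S. p \<in> U \<and> smooth_on U (\<phi> :: 'a \<Rightarrow> 'a) \<and> smooth_on V (\<psi> :: 'a \<Rightarrow> 'a) \<and>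
        homeomorphism U V \<phi> \<psi> \<and> subspace S \<and> dim S = d \<and> \<phi> ` (M \<inter> U) = S \<inter> V)"

definition smooth_curve_at ::
    "'a::euclidean_space set \<Rightarrow> (real \<Rightarrow> 'a) \<Rightarrow> 'a \<Rightarrow> 'a \<Rightarrow> bool" where
  "smooth_curve_at M \<gamma> p v \<longleftrightarrow>
     (\<exists>e>0. smooth_on {-e<..<e} \<gamma> \<and> \<gamma> ` {-e<..<e} \<subseteq> M) \<and>
     \<gamma> 0 = p \<and> (\<gamma> has_vector_derivative v) (at 0)"

definition tangent_space :: "'a::euclidean_space set \<Rightarrow> 'a \<Rightarrow> 'a set" where
  "tangent_space M p = {v. \<exists>\<gamma>. smooth_curve_at M \<gamma> p v}"

section \<open>Differential forms\<close>

text \<open>A 1-form \<open>\<eta>\<close> on a submanifold \<open>M\<close> is a function of a point \<open>p\<close> and a vector \<open>v\<close>; only its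
  values for \<open>p \<in> M\<close> and \<open>v \<in> tangent_space M p\<close> are relevant. Smooth 1-forms on \<open>M\<close> are
  those which locally are restrictions of smooth 1-forms \<open>\<theta>\<close> on open sets of the ambient space.\<close>

definition extends_one_form ::
    "'a::euclidean_space set \<Rightarrow> ('a \<Rightarrow> 'a \<Rightarrow> real) \<Rightarrow> 'a set \<Rightarrow> ('a \<Rightarrow> 'a \<Rightarrow> real) \<Rightarrow> bool" where
  "extends_one_form M \<eta> U \<theta> \<longleftrightarrow>
     (\<forall>x\<in>U. linear (\<theta> x)) \<and> (\<forall>v. smooth_on U (\<lambda>x. \<theta> x v)) \<and>
     (\<forall>x\<in>M \<inter> U. \<forall>v\<in>tangent_space M x. \<theta> x v = \<eta> x v)"

definition smooth_one_form :: "'a::euclidean_space set \<Rightarrow> ('a \<Rightarrow> 'a \<Rightarrow> real) \<Rightarrow> bool" where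
  "smooth_one_form M \<eta> \<longleftrightarrow> (\<forall>p\<in>M. \<exists>U \<theta>. p \<in> U \<and> extends_one_form M \<eta> U \<theta>)"

text \<open>\<open>\<omega>\<close> represents the exterior derivative of \<open>\<eta>\<close>, computed from a local extension \<open>\<theta>\<close> as
  \<open>d\<theta>(u, v) = D\<^sub>u(\<theta>(v)) - D\<^sub>v(\<theta>(u))\<close> for constant vector fields \<open>u\<close>, \<open>v\<close>. Since pulling back to \<open>M\<close>
  commutes with the exterior derivative, the result does not depend on \<open>\<theta>\<close>; so \<open>\<omega>\<close> is determined
  on tangent vectors.\<close>

definition is_exterior_derivative ::
    "'a::euclidean_space set \<Rightarrow> ('a \<Rightarrow> 'a \<Rightarrow> real) \<Rightarrow> ('a \<Rightarrow> 'a \<Rightarrow> 'a \<Rightarrow> real) \<Rightarrow> bool" where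
  "is_exterior_derivative M \<eta> \<omega> \<longleftrightarrow>
     (\<forall>p\<in>M. \<exists>U \<theta>. p \<in> U \<and> extends_one_form M \<eta> U \<theta> \<and>
        (\<forall>u\<in>tangent_space M p. \<forall>v\<in>tangent_space M p.
           \<omega> p u v = frechet_derivative (\<lambda>x. \<theta> x v) (at p) u
                   - frechet_derivative (\<lambda>x. \<theta> x u) (at p) v))"

text \<open>An alternating \<open>p\<close>-form on a vector space is encoded as a function of a sequence of vectors
  of which only the entries with index below \<open>p\<close> are used.\<close>

definition wedge ::
    "nat \<Rightarrow> nat \<Rightarrow> ((nat \<Rightarrow> 'a) \<Rightarrow> real) \<Rightarrow> ((nat \<Rightarrow> 'a) \<Rightarrow> real) \<Rightarrow> (nat \<Rightarrow> 'a) \<Rightarrow> real" where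
  "wedge p q \<alpha> \<beta> v =
     (\<Sum>\<sigma> | \<sigma> permutes {..<p + q}.
        of_int (sign \<sigma>) * \<alpha> (\<lambda>i. v (\<sigma> i)) * \<beta> (\<lambda>i. v (\<sigma> (p + i)))) / (fact p * fact q)"

primrec wedge_power ::
    "nat \<Rightarrow> ((nat \<Rightarrow> 'a) \<Rightarrow> real) \<Rightarrow> nat \<Rightarrow> (nat \<Rightarrow> 'a) \<Rightarrow> real" where
  "wedge_power p \<alpha> 0 = (\<lambda>v. 1)"
| "wedge_power p \<alpha> (Suc k) = wedge (p * k) p (wedge_power p \<alpha> k) \<alpha>"

definition contact_form_on :: "nat \<Rightarrow> 'a::euclidean_space set \<Rightarrow> ('a \<Rightarrow> 'a \<Rightarrow> real) \<Rightarrow> bool" where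
  "contact_form_on k M \<eta> \<longleftrightarrow> smooth_one_form M \<eta> \<and>
     (\<exists>\<omega>. is_exterior_derivative M \<eta> \<omega> \<and>
        (\<forall>p\<in>M. \<exists>v. range v \<subseteq> tangent_space M p \<and>
           wedge (2 * k) 1 (wedge_power 2 (\<lambda>u. \<omega> p (u 0) (u 1)) k) (\<lambda>u. \<eta> p (u 0)) v \<noteq> 0))"

section \<open>Lie groups\<close>

text \<open>Every Lie group is isomorphic to one whose underlying manifold is embedded in a Euclidean
  space.\<close>

definition lie_group :: "nat \<Rightarrow> 'a::euclidean_space monoid \<Rightarrow> bool" where
  "lie_group d G \<longleftrightarrow> group G \<and> smooth_submanifold d (carrier G) \<and>
     smooth_map_on (carrier G \<times> carrier G) (\<lambda>(x, y). x \<otimes>\<^bsub>G\<^esub> y) \<and>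
     smooth_map_on (carrier G) (m_inv G)"

definition lie_group_isomorphic ::
    "'a::euclidean_space monoid \<Rightarrow> 'b::euclidean_space monoid \<Rightarrow> bool" where
  "lie_group_isomorphic G K \<longleftrightarrow>
     (\<exists>f. f \<in> iso G K \<and> smooth_map_on (carrier G) f \<and>
          smooth_map_on (carrier K) (inv_into (carrier G) f))"

text \<open>If \<open>v\<close> is the velocity of \<open>\<gamma>\<close> at \<open>h\<close>, then the differential of the left translation by \<open>g\<close>
  sends \<open>v\<close> to the velocity \<open>w\<close> of the translated curve; so the following is
  \<open>(L\<^sub>g)\<^sup>* \<eta> = \<eta>\<close>.\<close>

definition left_invariant :: "'a::euclidean_space monoid \<Rightarrow> ('a \<Rightarrow> 'a \<Rightarrow> real) \<Rightarrow> bool" where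
  "left_invariant G \<eta> \<longleftrightarrow>
     (\<forall>g\<in>carrier G. \<forall>h\<in>carrier G. \<forall>\<gamma> v w.
        smooth_curve_at (carrier G) \<gamma> h v \<longrightarrow>
        smooth_curve_at (carrier G) (\<lambda>t. g \<otimes>\<^bsub>G\<^esub> \<gamma> t) (g \<otimes>\<^bsub>G\<^esub> h) w \<longrightarrow>
        \<eta> (g \<otimes>\<^bsub>G\<^esub> h) w = \<eta> h v)"

definition contact_lie_group :: "'a::euclidean_space monoid \<Rightarrow> bool" where
  "contact_lie_group G \<longleftrightarrow>
     (\<exists>k. lie_group (2 * k + 1) G \<and>
        (\<exists>\<eta>. left_invariant G \<eta> \<and> contact_form_on k (carrier G) \<eta>))"

section \<open>Linear and affine groups\<close>

text \<open>Linear diffeomorphisms of \<open>\<real>\<^sup>n\<close> are identified with their matrices, acting by \<open>(*v)\<close>.\<close>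

definition GL :: "(real^'n^'n) monoid" where
  "GL = \<lparr>carrier = {A. invertible A}, mult = (**), one = mat 1\<rparr>"

definition linear_hyperplane :: "(real^'n) set \<Rightarrow> bool" where
  "linear_hyperplane H \<longleftrightarrow> subspace H \<and> dim H = CARD('n) - 1"

definition hyperplane_stabilizer :: "(real^'n) set \<Rightarrow> (real^'n^'n) set" where
  "hyperplane_stabilizer H = {A \<in> carrier GL. (\<lambda>x. A *v x) ` H = H}"

definition eigenvector_subgroup :: "real^'n \<Rightarrow> (real^'n^'n) set" where
  "eigenvector_subgroup v = {A \<in> carrier GL. \<exists>c. A *v v = c *\<^sub>R v}"

text \<open>The pair \<open>(A, b)\<close> stands for the affine diffeomorphism \<open>x \<mapsto> A x + b\<close>; this gives
  the affine group its usual manifold structure. That the pairs form the group of affine bijections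
  under composition is the lemma \<open>affine_map_iso\<close> below.\<close>

definition Aff :: "((real^'m^'m) \<times> (real^'m)) monoid" where
  "Aff = \<lparr>carrier = {(A, b). invertible A},
          mult = (\<lambda>(A, b) (C, d). (A ** C, A *v d + b)),
          one = (mat 1, 0)\<rparr>"

definition affine_map :: "(real^'m^'m) \<times> (real^'m) \<Rightarrow> real^'m \<Rightarrow> real^'m" where
  "affine_map = (\<lambda>(A, b) x. A *v x + b)"

definition affine_bijections :: "(real^'m \<Rightarrow> real^'m) monoid" where
  "affine_bijections =
     \<lparr>carrier = {f. bij f \<and> (\<exists>L c. linear L \<and> f = (\<lambda>x. L x + c))}, mult = (\<circ>), one = id\<rparr>"

lemma bij_affine_map: "bij (\<lambda>x. A *v x + b) \<longleftrightarrow> invertible (A :: real^'m^'m)"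
proof -
  let ?t = "\<lambda>c y. y + c :: real^'m"
  have t: "bij (?t c)" for c
    by (rule o_bij[where g = "?t (- c)"]) (auto simp: fun_eq_iff)
  have "(\<lambda>x. A *v x + b) = ?t b \<circ> (\<lambda>x. A *v x)"
    and "(\<lambda>x. A *v x) = ?t (- b) \<circ> (\<lambda>x. A *v x + b)"
    by (auto simp: fun_eq_iff)
  then have "bij (\<lambda>x. A *v x + b) \<longleftrightarrow> bij (\<lambda>x. A *v x)"
    using t by (metis bij_comp)
  then show ?thesis
    by (metis invertible_eq_bij)
qed

lemma affine_map_iso:
  "affine_map \<in> iso (Aff :: ((real^'m^'m) \<times> (real^'m)) monoid) affine_bijections"
proof -
  have inj: "inj_on affine_map (carrier (Aff :: ((real^'m^'m) \<times> (real^'m)) monoid))"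
  proof (rule inj_onI, clarify)
    fix A C :: "real^'m^'m" and b d :: "real^'m"
    assume "affine_map (A, b) = affine_map (C, d)"
    then have e: "A *v x + b = C *v x + d" for x
      unfolding affine_map_def by (simp add: fun_eq_iff)
    from e[of 0] have "b = d" by simp
    moreover from this e have "A = C" by (simp add: matrix_eq)
    ultimately show "A = C \<and> b = d" by simp
  qed
  have "affine_map ` carrier (Aff :: ((real^'m^'m) \<times> (real^'m)) monoid) = carrier affine_bijections"
  proof
    show "affine_map ` carrier (Aff :: ((real^'m^'m) \<times> (real^'m)) monoid) \<subseteq> carrier affine_bijections"
      by (auto simp: Aff_def affine_bijections_def affine_map_def bij_affine_map)
  next
    show "carrier affine_bijections \<subseteq> affine_map ` carrier (Aff :: ((real^'m^'m) \<times> (real^'m)) monoid)"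
    proof
      fix f :: "real^'m \<Rightarrow> real^'m"
      assume "f \<in> carrier affine_bijections"
      then obtain L c where L: "bij f" "linear L" "f = (\<lambda>x. L x + c)"
        by (auto simp: affine_bijections_def)
      then have f: "f = (\<lambda>x. matrix L *v x + c)"
        by (simp add: matrix_works)
      with L(1) have "invertible (matrix L)"
        by (metis bij_affine_map)
      with f show "f \<in> affine_map ` carrier Aff"
        by (intro image_eqI[of _ _ "(matrix L, c)"]) (auto simp: Aff_def affine_map_def)
    qed
  qed
  moreover from this have "affine_map \<in> hom (Aff :: ((real^'m^'m) \<times> (real^'m)) monoid) affine_bijections"
    by (auto simp: hom_def Aff_def affine_bijections_def affine_map_def fun_eq_iff
        matrix_vector_mul_assoc matrix_vector_right_distrib)
  ultimately show ?thesis
    using inj by (simp add: iso_def bij_betw_def)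
qed

end

theory Submission
  imports Defs
begin

text \<open>
  Both groups consist of the invertible elements of a unital subalgebra \<open>S\<close> of the matrix algebra:
  the matrices with eigenvector \<open>v\<close>, and the matrices which multiply a normal functional of the
  hyperplane by a scalar. Such a group is an open subset of the vector space \<open>S\<close>, so it is a Lie
  group of dimension \<open>dim S\<close> whose tangent space at \<open>A\<close> is \<open>A S = S\<close>. A linear functional \<open>f\<close> on
  \<open>S\<close> gives the left invariant form \<open>\<eta>\<^sub>A(V) = f(A\<^sup>-\<^sup>1 V)\<close>, and differentiating the inverse yields
  \<open>d\<eta>\<^sub>A(A X, A Y) = f(Y X - X Y)\<close>.

  So \<open>\<eta>\<close> is a contact form as soon as \<open>f 1 \<noteq> 0\<close> and only the scalar matrices of \<open>S\<close> are orthogonal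
  to \<open>S\<close> for the bilinear form \<open>f(Y X - X Y)\<close>: this form is then nondegenerate on the kernel of \<open>f\<close>
  in \<open>S\<close>, a symplectic basis of the kernel (\<open>symplectic_basis_exists\<close>) shows that \<open>dim S\<close> is odd,
  and together with the identity matrix it is a basis on which \<open>(d\<eta>)\<^sup>k \<and> \<eta>\<close> does not vanish
  (\<open>wedge_power_wedge_symplectic_nonzero\<close>). This is \<open>contact_lie_group_units_of_subalgebra\<close>.

  Such a functional is written down explicitly for a coordinate vector
  (\<open>contact_functional_axis\<close>). Conjugating by an orthogonal matrix transports it to any \<open>v \<noteq> 0\<close>,
  and transposition, an anti-automorphism, transports it to the algebra of a hyperplane.

  The normal subgroup consists of the matrices that fix the normal functional of the hyperplane. In
  coordinates adapted to the hyperplane it consists of the block matrices with rows \<open>(A, b)\<close> and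
  \<open>(0, 1)\<close>, the usual linear model of the affine group. Its codimension is \<open>1\<close> because the identity
  matrix and the matrices that annihilate the normal functional span the algebra of the hyperplane.
\<close>

section \<open>Alternating forms on symplectic sequences\<close>

text \<open>
  The transposition of two numbers, as opposed to the transpose of a matrix.
\<close>

abbreviation swap :: "nat \<Rightarrow> nat \<Rightarrow> nat \<Rightarrow> nat" where "swap \<equiv> Transposition.transpose"

lemma sign_mult_sign_mult: "of_int (sign \<sigma>) * (of_int (sign \<sigma>) * x) = (x :: real)"
  by (cases \<sigma> rule: sign_cases) auto

lemma wedge_cong:
  assumes "\<And>i. i < p + q \<Longrightarrow> u i = v i"
    and \<alpha>: "\<And>x y. (\<And>i. i < p \<Longrightarrow> x i = y i) \<Longrightarrow> \<alpha> x = \<alpha> y"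
    and \<beta>: "\<And>x y. (\<And>i. i < q \<Longrightarrow> x i = y i) \<Longrightarrow> \<beta> x = \<beta> y"
  shows "wedge p q \<alpha> \<beta> u = wedge p q \<alpha> \<beta> v"
proof -
  have "\<alpha> (\<lambda>i. u (\<sigma> i)) = \<alpha> (\<lambda>i. v (\<sigma> i)) \<and> \<beta> (\<lambda>i. u (\<sigma> (p + i))) = \<beta> (\<lambda>i. v (\<sigma> (p + i)))"
    if "\<sigma> permutes {..<p + q}" for \<sigma>
  proof -
    have "u (\<sigma> i) = v (\<sigma> i)" if "i < p + q" for i
      using permutes_in_image[OF \<open>\<sigma> permutes _\<close>, of i] that assms(1) by simp
    then show ?thesis by (intro conjI \<alpha> \<beta>) auto
  qed
  then show ?thesis
    unfolding wedge_def by (intro arg_cong2[where f = "(/)"] sum.cong) auto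
qed

text \<open>
  Reindexing the defining sum by \<open>\<sigma> \<mapsto> \<tau> \<circ> \<sigma>\<close> changes each sign by that of \<open>\<tau>\<close>: the
  sum over all permutations antisymmetrizes.
\<close>

lemma wedge_alternating:
  assumes \<tau>: "\<tau> permutes {..<p + q}"
  shows "wedge p q \<alpha> \<beta> (v \<circ> \<tau>) = of_int (sign \<tau>) * wedge p q \<alpha> \<beta> v"
proof -
  let ?t = "\<lambda>\<sigma>. \<alpha> (\<lambda>i. v (\<sigma> i)) * \<beta> (\<lambda>i. v (\<sigma> (p + i)))"
  have P: "permutation \<tau>" using \<tau> permutation_permutes by blast
  have "(\<Sum>\<sigma> | \<sigma> permutes {..<p + q}. of_int (sign \<sigma>) * ?t (\<tau> \<circ> \<sigma>))
      = (\<Sum>\<sigma> | \<sigma> permutes {..<p + q}. of_int (sign \<tau>) * (of_int (sign (\<tau> \<circ> \<sigma>)) * ?t (\<tau> \<circ> \<sigma>)))"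
  proof (rule sum.cong)
    fix \<sigma> assume "\<sigma> \<in> {\<sigma>. \<sigma> permutes {..<p + q}}"
    then have "permutation \<sigma>" using permutation_permutes by blast
    then have "sign \<sigma> = sign \<tau> * sign (\<tau> \<circ> \<sigma>)" using P by (simp add: sign_compose)
    then show "of_int (sign \<sigma>) * ?t (\<tau> \<circ> \<sigma>) = of_int (sign \<tau>) * (of_int (sign (\<tau> \<circ> \<sigma>)) * ?t (\<tau> \<circ> \<sigma>))"
      by simp
  qed simp
  also have "\<dots> = of_int (sign \<tau>) * (\<Sum>\<sigma> | \<sigma> permutes {..<p + q}. of_int (sign \<sigma>) * ?t \<sigma>)"
    unfolding sum_distrib_left[symmetric]
    by (subst (2) setum_permutations_compose_left[OF \<tau>]) (rule refl)
  finally show ?thesis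
    unfolding wedge_def by (simp add: mult.assoc)
qed

lemma wedge_power_cong:
  assumes "\<And>x y. (\<And>i. i < p \<Longrightarrow> x i = y i) \<Longrightarrow> \<alpha> x = \<alpha> y"
    and "\<And>i. i < p * k \<Longrightarrow> u i = v i"
  shows "wedge_power p \<alpha> k u = wedge_power p \<alpha> k v"
  using assms(2)
proof (induction k arbitrary: u v)
  case (Suc k)
  have "wedge (p * k) p (wedge_power p \<alpha> k) \<alpha> u = wedge (p * k) p (wedge_power p \<alpha> k) \<alpha> v"
  proof (rule wedge_cong)
    show "u i = v i" if "i < p * k + p" for i
      using Suc.prems[of i] that by (simp add: add.commute)
  qed (use Suc.IH assms(1) in blast)+
  then show ?case by simp
qed simp

lemma wedge_power_alternating:
  assumes "\<tau> permutes {..<p * k}"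
  shows "wedge_power p \<alpha> k (v \<circ> \<tau>) = of_int (sign \<tau>) * wedge_power p \<alpha> k v"
proof (cases k)
  case 0
  then show ?thesis using assms by simp
next
  case (Suc l)
  then show ?thesis using assms wedge_alternating[of \<tau> "p * l" p] by (simp add: algebra_simps)
qed

text \<open>
  The first \<open>2k\<close> vectors form the hyperbolic pairs \<open>(v\<^sub>0, v\<^sub>1), (v\<^sub>2, v\<^sub>3), \<dots>\<close>: inside a pair the
  difference of the parities of the indices is the value \<open>1\<close>, \<open>- 1\<close> or \<open>0\<close> of \<open>\<omega>\<close>. Written with
  \<open>div 2\<close> and \<open>mod 2\<close>, the pattern is visibly stable under permutations of the pairs.
\<close>

definition symplectic_sequence :: "('a \<Rightarrow> 'a \<Rightarrow> real) \<Rightarrow> nat \<Rightarrow> (nat \<Rightarrow> 'a) \<Rightarrow> bool" where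
  "symplectic_sequence \<omega> k v \<longleftrightarrow> (\<forall>i<2*k. \<forall>j<2*k. \<omega> (v i) (v j) =
     (if i div 2 = j div 2 then real (j mod 2) - real (i mod 2) else 0))"

text \<open>
  The exchange of the pairs with numbers \<open>j\<close> and \<open>k\<close>, which is the identity if \<open>j = k\<close>. As a
  composition of two transpositions, or of two identities, it is even.
\<close>

definition swap_pairs :: "nat \<Rightarrow> nat \<Rightarrow> nat \<Rightarrow> nat" where
  "swap_pairs j k = swap (2 * j) (2 * k) \<circ> swap (2 * j + 1) (2 * k + 1)"

lemma swap_pairs_apply:
  "swap_pairs j k i =
    (if i div 2 = j then 2 * k + i mod 2 else if i div 2 = k then 2 * j + i mod 2 else i)"
proof -
  obtain q where "i = 2 * q \<or> i = 2 * q + 1" by (metis evenE oddE)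
  then show ?thesis
    by (elim disjE)
      (auto simp: swap_pairs_def Transposition.transpose_def Suc_double_not_eq_double
        double_not_eq_Suc_double)
qed

lemma swap_pairs_div_mod:
  "swap_pairs j k i mod 2 = i mod 2"
  "swap_pairs j k i div 2 = (if i div 2 = j then k else if i div 2 = k then j else i div 2)"
  unfolding swap_pairs_apply by auto

lemma swap_pairs_swap_pairs: "swap_pairs j k (swap_pairs j k i) = i"
proof -
  let ?i = "swap_pairs j k (swap_pairs j k i)"
  have "?i = ?i div 2 * 2 + ?i mod 2" by (rule div_mult_mod_eq[symmetric])
  also have "\<dots> = i div 2 * 2 + i mod 2"
    unfolding swap_pairs_div_mod by (cases "i div 2 = j"; cases "i div 2 = k") simp_all
  finally show ?thesis by (simp only: div_mult_mod_eq)
qed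

lemma swap_pairs_permutes: "j < n \<Longrightarrow> k < n \<Longrightarrow> swap_pairs j k permutes {..<2 * n}"
  unfolding swap_pairs_def by (intro permutes_compose permutes_swap_id) auto

lemma sign_swap_pairs: "sign (swap_pairs j k) = 1"
  unfolding swap_pairs_def by (simp add: sign_compose permutation_swap_id sign_swap_id)

lemma symplectic_sequence_swap_pairs:
  assumes v: "symplectic_sequence \<omega> n v" and "j < n" "k < n"
  shows "symplectic_sequence \<omega> n (v \<circ> swap_pairs j k)"
proof -
  have l: "swap_pairs j k i < 2 * n" if "i < 2 * n" for i
    using permutes_in_image[OF swap_pairs_permutes[OF assms(2,3)], of i] that by simp
  have d: "swap_pairs j k a div 2 = swap_pairs j k b div 2 \<longleftrightarrow> a div 2 = b div 2" for a b
    by (auto simp: swap_pairs_div_mod)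
  show ?thesis
    using v unfolding symplectic_sequence_def by (simp add: l d swap_pairs_div_mod(1))
qed

text \<open>
  By induction every term of the sum defining \<open>\<omega>\<^sup>k\<^sup>+\<^sup>1 = \<omega>\<^sup>k \<and> \<omega>\<close> is nonnegative, and the term of the
  identity is positive. A term can only be nonzero if the last two vectors belong to one pair. Up to
  the transposition of the last two positions, which changes both the sign of \<open>\<sigma>\<close> and that of the
  last factor, this pair is in its natural order; moving it to the end by the even permutation
  \<open>swap_pairs\<close> gives again a symplectic sequence, of which \<open>\<sigma>\<close> only permutes the first \<open>2k\<close>
  vectors, so the induction hypothesis applies.
\<close>

theorem wedge_power_symplectic_pos:
  assumes "symplectic_sequence \<omega> k v"
  shows "wedge_power 2 (\<lambda>u. \<omega> (u 0) (u 1)) k v > 0"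
  using assms
proof (induction k arbitrary: v)
  case (Suc k)
  let ?W = "wedge_power 2 (\<lambda>u. \<omega> (u 0) (u 1)) k"
  let ?S = "{\<sigma>. \<sigma> permutes {..<2 * k + 2}}"
  let ?t = "\<lambda>\<sigma>. of_int (sign \<sigma>) * ?W (\<lambda>i. v (\<sigma> i)) * \<omega> (v (\<sigma> (2 * k))) (v (\<sigma> (2 * k + 1)))"
  note pat = Suc.prems[unfolded symplectic_sequence_def, rule_format]
  have Wcong: "?W x = ?W y" if "\<And>i. i < 2 * k \<Longrightarrow> x i = y i" for x y
    by (rule wedge_power_cong) (use that in auto)
  have sub: "symplectic_sequence \<omega> k x" if "symplectic_sequence \<omega> (Suc k) x" for x
    using that by (auto simp: symplectic_sequence_def)
  have ordered: "?t \<sigma> > 0"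
    if \<sigma>: "\<sigma> \<in> ?S" and j: "\<sigma> (2 * k) = 2 * j" "\<sigma> (2 * k + 1) = 2 * j + 1" for \<sigma> j
  proof -
    have "\<sigma> (2 * k) < 2 * k + 2"
      using permutes_in_image[of \<sigma> "{..<2 * k + 2}" "2 * k"] \<sigma> by simp
    then have jk: "j \<le> k" using j by simp
    let ?\<tau> = "swap_pairs j k"
    have \<tau>: "?\<tau> permutes {..<2 * k + 2}"
      using swap_pairs_permutes[of j "Suc k" k] jk by simp
    \<comment> \<open>\<open>\<rho>\<close> fixes the last two positions and has the sign of \<open>\<sigma>\<close>, so the two signs cancel.\<close>
    define \<rho> where "\<rho> = ?\<tau> \<circ> \<sigma>"
    have "\<rho> permutes {..<2 * k + 2}"
      unfolding \<rho>_def using \<sigma> \<tau> by (auto intro: permutes_compose)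
    moreover have "\<rho> (2 * k) = 2 * k" "\<rho> (2 * k + 1) = 2 * k + 1"
      unfolding \<rho>_def comp_def j by (simp_all add: swap_pairs_apply)
    ultimately have \<rho>: "\<rho> permutes {..<2 * k}"
      by (elim permutes_superset) (auto simp: less_Suc_eq)
    have "permutation ?\<tau>" "permutation \<sigma>"
      using \<sigma> \<tau> by (auto simp: permutation_permutes)
    then have s: "sign \<rho> = sign \<sigma>" unfolding \<rho>_def by (simp add: sign_compose sign_swap_pairs)
    have "(\<lambda>i. v (\<sigma> i)) = (v \<circ> ?\<tau>) \<circ> \<rho>"
      by (simp add: fun_eq_iff \<rho>_def swap_pairs_swap_pairs)
    then have "?W (\<lambda>i. v (\<sigma> i)) = of_int (sign \<sigma>) * ?W (v \<circ> ?\<tau>)"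
      using wedge_power_alternating[OF \<rho>, of "\<lambda>u. \<omega> (u 0) (u 1)" "v \<circ> ?\<tau>"] s by simp
    moreover have "\<omega> (v (\<sigma> (2 * k))) (v (\<sigma> (2 * k + 1))) = 1"
      unfolding j using jk by (subst pat) auto
    moreover have "?W (v \<circ> ?\<tau>) > 0"
      using symplectic_sequence_swap_pairs[OF Suc.prems, of j k] jk
      by (intro Suc.IH sub) (simp add: less_Suc_eq_le comp_def)
    ultimately show ?thesis by (simp add: mult.assoc sign_mult_sign_mult)
  qed
  have nonneg: "?t \<sigma> \<ge> 0" if \<sigma>: "\<sigma> \<in> ?S" for \<sigma>
  proof -
    define a where "a = \<sigma> (2 * k)"
    define b where "b = \<sigma> (2 * k + 1)"
    have ab: "a < 2 * k + 2" "b < 2 * k + 2"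
      using permutes_in_image[of \<sigma> "{..<2 * k + 2}"] \<sigma> by (auto simp: a_def b_def)
    have "a \<noteq> b"
      unfolding a_def b_def using \<sigma> by (simp add: inj_eq[OF permutes_inj])
    then have "a div 2 \<noteq> b div 2 \<or> (\<exists>j. a = 2 * j \<and> b = 2 * j + 1) \<or> (\<exists>j. b = 2 * j \<and> a = 2 * j + 1)"
      by presburger
    then consider "a div 2 \<noteq> b div 2" | j where "a = 2 * j" "b = 2 * j + 1"
      | j where "b = 2 * j" "a = 2 * j + 1"
      by blast
    then show ?thesis
    proof cases
      case 1
      then have "\<omega> (v a) (v b) = 0" using ab by (subst pat) auto
      then show ?thesis by (simp add: a_def b_def)
    next
      case 2
      then show ?thesis using ordered[OF \<sigma>, of j] by (simp add: a_def b_def)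
    next
      case 3
      let ?s = "swap (2 * k) (2 * k + 1)"
      have "\<sigma> \<circ> ?s \<in> ?S"
        using \<sigma> by (auto intro!: permutes_compose permutes_swap_id)
      moreover have "permutation \<sigma>" using \<sigma> by (auto simp: permutation_permutes)
      then have "sign (\<sigma> \<circ> ?s) = - sign \<sigma>"
        by (simp add: sign_compose permutation_swap_id sign_swap_id)
      moreover have "?W (\<lambda>i. v ((\<sigma> \<circ> ?s) i)) = ?W (\<lambda>i. v (\<sigma> i))"
        by (rule Wcong) (auto simp: Transposition.transpose_def)
      moreover have "\<omega> (v a) (v b) = - \<omega> (v b) (v a)"
        using ab 3 by (simp add: pat)
      ultimately show ?thesis
        using ordered[of "\<sigma> \<circ> ?s" j] 3 by (simp add: a_def b_def)
    qed
  qed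
  have "?t id > 0"
    using ordered[of id k] by (simp add: permutes_id)
  then have pos: "(\<Sum>\<sigma>\<in>?S. ?t \<sigma>) > 0"
    by (intro sum_pos2[where i = id and f = ?t] nonneg finite_permutations finite_lessThan)
      (simp_all only: permutes_id mem_Collect_eq)
  have eq: "wedge_power 2 (\<lambda>u. \<omega> (u 0) (u 1)) (Suc k) v = (\<Sum>\<sigma>\<in>?S. ?t \<sigma>) / (fact (2 * k) * fact 2)"
    by (simp only: wedge_power.simps wedge_def add_0_right)
  show ?case
    unfolding eq by (intro divide_pos_pos mult_pos_pos fact_gt_zero pos)
qed simp

text \<open>
  As \<open>\<eta>\<close> kills all vectors but the last one, only the permutations that fix the last position
  contribute, and each of them contributes the same value.
\<close>

theorem wedge_power_wedge_symplectic_nonzero: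
  assumes v: "symplectic_sequence \<omega> k v"
    and \<eta>: "\<And>i. i < 2 * k \<Longrightarrow> \<eta> (v i) = 0" and nz: "\<eta> (v (2 * k)) \<noteq> 0"
  shows "wedge (2 * k) 1 (wedge_power 2 (\<lambda>u. \<omega> (u 0) (u 1)) k) (\<lambda>u. \<eta> (u 0)) v \<noteq> 0"
proof -
  let ?W = "wedge_power 2 (\<lambda>u. \<omega> (u 0) (u 1)) k"
  let ?t = "\<lambda>\<sigma>. of_int (sign \<sigma>) * ?W (\<lambda>i. v (\<sigma> i)) * \<eta> (v (\<sigma> (2 * k)))"
  have "(\<Sum>\<sigma> | \<sigma> permutes {..<2 * k + 1}. ?t \<sigma>) = (\<Sum>\<sigma> | \<sigma> permutes {..<2 * k}. ?t \<sigma>)"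
  proof (rule sum.mono_neutral_right)
    show "finite {\<sigma>. \<sigma> permutes {..<2 * k + 1}}" by (simp add: finite_permutations)
    show "{\<sigma>. \<sigma> permutes {..<2 * k}} \<subseteq> {\<sigma>. \<sigma> permutes {..<2 * k + 1}}"
      by (auto intro: permutes_subset)
    show "\<forall>\<sigma>\<in>{\<sigma>. \<sigma> permutes {..<2 * k + 1}} - {\<sigma>. \<sigma> permutes {..<2 * k}}. ?t \<sigma> = 0"
    proof
      fix \<sigma> assume "\<sigma> \<in> {\<sigma>. \<sigma> permutes {..<2 * k + 1}} - {\<sigma>. \<sigma> permutes {..<2 * k}}"
      then have \<sigma>: "\<sigma> permutes {..<2 * k + 1}" "\<not> \<sigma> permutes {..<2 * k}" by auto
      have "\<sigma> (2 * k) \<noteq> 2 * k"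
        using \<sigma> permutes_superset[OF \<sigma>(1), of "{..<2 * k}"] by (auto simp: less_Suc_eq)
      then have "\<sigma> (2 * k) < 2 * k"
        using permutes_in_image[OF \<sigma>(1), of "2 * k"] by simp
      then show "?t \<sigma> = 0" by (simp add: \<eta>)
    qed
  qed
  also have "\<dots> = (\<Sum>\<sigma> | \<sigma> permutes {..<2 * k}. ?W v * \<eta> (v (2 * k)))"
  proof (rule sum.cong)
    fix \<sigma> assume "\<sigma> \<in> {\<sigma>. \<sigma> permutes {..<2 * k}}"
    then have \<sigma>: "\<sigma> permutes {..<2 * k}" by simp
    have "?W (\<lambda>i. v (\<sigma> i)) = of_int (sign \<sigma>) * ?W v"
      using wedge_power_alternating[OF \<sigma>, of "\<lambda>u. \<omega> (u 0) (u 1)" v] by (simp add: comp_def)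
    moreover have "\<sigma> (2 * k) = 2 * k"
      using \<sigma> by (simp add: permutes_def)
    ultimately show "?t \<sigma> = ?W v * \<eta> (v (2 * k))" by (simp add: mult.assoc sign_mult_sign_mult)
  qed simp
  also have "\<dots> = fact (2 * k) * (?W v * \<eta> (v (2 * k)))"
    unfolding sum_constant by (subst card_permutations[of _ "2 * k"]) simp_all
  finally have "wedge (2 * k) 1 ?W (\<lambda>u. \<eta> (u 0)) v
      = fact (2 * k) * (?W v * \<eta> (v (2 * k))) / (fact (2 * k) * fact 1)"
    by (simp only: wedge_def add_0_right)
  then show ?thesis
    using wedge_power_symplectic_pos[OF v] nz by simp
qed

text \<open>
  Symplectic Gram-Schmidt: a hyperbolic pair \<open>x, y\<close> splits off, and its orthogonal complement \<open>T\<close>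
  in \<open>S\<close> is again nondegenerate and has two dimensions less. In particular \<open>dim S\<close> is even.
\<close>

theorem symplectic_basis_exists:
  fixes S :: "'a::euclidean_space set"
  assumes "subspace S" and lin: "bilinear \<omega>" and alt: "\<And>x. \<omega> x x = 0"
    and "\<And>x. x \<in> S \<Longrightarrow> (\<And>y. y \<in> S \<Longrightarrow> \<omega> x y = 0) \<Longrightarrow> x = 0"
  shows "\<exists>k v. dim S = 2 * k \<and> range v \<subseteq> S \<and> symplectic_sequence \<omega> k v"
  using assms(1,4)
proof (induction "dim S" arbitrary: S rule: less_induct)
  case (less S)
  note \<omega> = bilinear_ladd[OF lin] bilinear_radd[OF lin] bilinear_lmul[OF lin] bilinear_rmul[OF lin]
    bilinear_lsub[OF lin] bilinear_rsub[OF lin]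
  have skew: "\<omega> x y = - \<omega> y x" for x y
  proof -
    have "\<omega> (x + y) (x + y) = \<omega> x y + \<omega> y x"
      unfolding \<omega>(1,2) by (simp add: alt)
    then show ?thesis by (simp add: alt)
  qed
  show ?case
  proof (cases "S = {0}")
    case True
    then show ?thesis
      by (intro exI[of _ 0] exI[of _ "\<lambda>_. 0"]) (auto simp: symplectic_sequence_def)
  next
    case False
    then obtain x where "x \<in> S" "x \<noteq> 0" using subspace_0[OF less.prems(1)] by blast
    then obtain z where z: "z \<in> S" "\<omega> x z \<noteq> 0" using less.prems(2) by blast
    define y where "y = (1 / \<omega> x z) *\<^sub>R z"
    have x: "x \<in> S" and y: "y \<in> S" and xy: "\<omega> x y = 1" and yx: "\<omega> y x = - 1"
      using \<open>x \<in> S\<close> z less.prems(1) by (auto simp: y_def subspace_scale \<omega> skew[of z x])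
    define T where "T = {s \<in> S. \<omega> s x = 0 \<and> \<omega> s y = 0}"
    have T: "subspace T"
      using less.prems(1) unfolding T_def subspace_def
      by (auto simp: \<omega> bilinear_lzero[OF lin])
    \<comment> \<open>The projection of \<open>s\<close> to \<open>T\<close> along the plane of \<open>x\<close> and \<open>y\<close>.\<close>
    have split: "s - \<omega> s y *\<^sub>R x + \<omega> s x *\<^sub>R y \<in> T" if "s \<in> S" for s
      unfolding T_def using that x y less.prems(1)
      by (auto simp: \<omega> alt xy yx intro!: subspace_add subspace_diff subspace_scale)
    have S: "S = span (insert x (insert y T))"
    proof
      show "span (insert x (insert y T)) \<subseteq> S"
        by (rule span_minimal) (use x y less.prems(1) in \<open>auto simp: T_def\<close>)
      show "S \<subseteq> span (insert x (insert y T))"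
      proof
        fix s assume "s \<in> S"
        have "s = (s - \<omega> s y *\<^sub>R x + \<omega> s x *\<^sub>R y) + \<omega> s y *\<^sub>R x - \<omega> s x *\<^sub>R y" by simp
        also have "\<dots> \<in> span (insert x (insert y T))"
          by (intro span_add span_diff span_scale span_base) (use split[OF \<open>s \<in> S\<close>] in auto)
        finally show "s \<in> span (insert x (insert y T))" .
      qed
    qed
    have "y \<notin> span T" using T yx by (simp add: span_eq_iff[THEN iffD2] T_def)
    moreover have "x \<notin> span (insert y T)"
    proof
      assume "x \<in> span (insert y T)"
      then obtain c where "x - c *\<^sub>R y \<in> span T" by (auto simp: span_breakdown_eq)
      then have "x - c *\<^sub>R y \<in> T" using T by (simp add: span_eq_iff[THEN iffD2])
      then show False by (simp add: T_def \<omega> xy alt)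
    qed
    ultimately have dim: "dim S = dim T + 2"
      using S by (simp add: dim_insert)
    have "t = 0" if t: "t \<in> T" "\<And>s. s \<in> T \<Longrightarrow> \<omega> t s = 0" for t
    proof (rule less.prems(2))
      show "t \<in> S" using t by (simp add: T_def)
      fix s assume "s \<in> S"
      from t(2)[OF split[OF this]] show "\<omega> t s = 0"
        using t(1) by (simp add: T_def \<omega>)
    qed
    then obtain k v where kv: "dim T = 2 * k" "range v \<subseteq> T" "symplectic_sequence \<omega> k v"
      using less.hyps[of T] T dim by auto
    define u where "u i = (if i < 2 * k then v i else if i = 2 * k then x else y)" for i
    have vT: "v i \<in> T" for i using kv by auto
    have v0: "\<omega> (v i) x = 0" "\<omega> (v i) y = 0" "\<omega> x (v i) = 0" "\<omega> y (v i) = 0" for i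
      using vT[of i] by (auto simp: T_def skew[of x] skew[of y])
    have "symplectic_sequence \<omega> (Suc k) u"
      unfolding symplectic_sequence_def
    proof (intro allI impI)
      fix i j assume ij: "i < 2 * Suc k" "j < 2 * Suc k"
      then have c: "i < 2 * k \<or> i = 2 * k \<or> i = 2 * k + 1" "j < 2 * k \<or> j = 2 * k \<or> j = 2 * k + 1"
        by auto
      then show "\<omega> (u i) (u j) = (if i div 2 = j div 2 then real (j mod 2) - real (i mod 2) else 0)"
        using kv(3)[unfolded symplectic_sequence_def, rule_format, of i j]
        by (elim disjE) (auto simp: u_def v0 xy yx alt)
    qed
    moreover have "range u \<subseteq> S" using vT x y by (auto simp: u_def T_def)
    ultimately show ?thesis
      using dim kv(1) by (intro exI[of _ "Suc k"] exI[of _ u]) simp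
  qed
qed

section \<open>Smooth maps and matrix inversion\<close>

lemma Ck_on_cong:
  assumes "open U" "\<And>x. x \<in> U \<Longrightarrow> f x = g x"
  shows "Ck_on k U f \<longleftrightarrow> Ck_on k U g"
proof -
  have "Ck_on k U g" if "Ck_on k U f" "\<And>x. x \<in> U \<Longrightarrow> f x = g x" for f g :: "'a \<Rightarrow> 'b"
    using that
  proof (induction k arbitrary: f g)
    case 0
    then show ?case by (simp cong: continuous_on_cong)
  next
    case (Suc k)
    have d: "(g has_derivative frechet_derivative f (at x)) (at x)" if "x \<in> U" for x
      using Suc.prems that has_derivative_transform_within_open[OF _ assms(1) that, of f _ UNIV g]
      by (simp add: frechet_derivative_works)
    have "Ck_on k U (\<lambda>x. frechet_derivative g (at x) v)" for v
    proof (rule Suc.IH)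
      show "Ck_on k U (\<lambda>x. frechet_derivative f (at x) v)" using Suc.prems(1) by simp
      show "frechet_derivative f (at x) v = frechet_derivative g (at x) v" if "x \<in> U" for x
        using frechet_derivative_at[OF d[OF that]] by simp
    qed
    then show ?case using d by (auto intro: differentiableI)
  qed
  from this[of f g] this[of g f] show ?thesis using assms(2) by auto
qed

text \<open>
  Unlike the recursive definition, this allows any formula for the derivative on \<open>U\<close>.
\<close>

lemma Ck_on_SucI:
  assumes "open U" and f': "\<And>x. x \<in> U \<Longrightarrow> (f has_derivative f' x) (at x)"
    and "\<And>v. Ck_on k U (\<lambda>x. f' x v)"
  shows "Ck_on (Suc k) U f"
proof -
  have "Ck_on k U (\<lambda>x. frechet_derivative f (at x) v)" for v
    using assms(3)[of v] frechet_derivative_at[OF f']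
    by (subst Ck_on_cong[OF assms(1)]) auto
  then show ?thesis using f' by (auto intro: differentiableI)
qed

lemma Ck_on_SucD: "Ck_on (Suc k) U f \<Longrightarrow> Ck_on k U f"
proof (induction k arbitrary: f)
  case 0
  then show ?case
    by (auto intro!: continuous_at_imp_continuous_on differentiable_imp_continuous_within)
next
  case (Suc k)
  then show ?case using Suc.IH by (subst Ck_on.simps(2)) (auto simp del: Ck_on.simps(1))
qed

lemma Ck_on_const: "Ck_on k U (\<lambda>x. c)"
  by (induction k arbitrary: c) (auto simp: frechet_derivative_const)

lemma Ck_on_linear:
  assumes f: "bounded_linear f"
  shows "Ck_on k U f"
proof (cases k)
  case 0
  then show ?thesis using linear_continuous_on[OF f] by simp
next
  case (Suc l)
  have "frechet_derivative f (at x) = f" for x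
    using frechet_derivative_at[OF bounded_linear_imp_has_derivative[OF f]] by simp
  then show ?thesis
    using Suc bounded_linear_imp_differentiable[OF f] by (simp add: Ck_on_const)
qed

lemma Ck_on_add:
  assumes "open U" "Ck_on k U f" "Ck_on k U g"
  shows "Ck_on k U (\<lambda>x. f x + g x)"
  using assms(2,3)
proof (induction k arbitrary: f g)
  case 0
  then show ?case by (simp add: continuous_on_add)
next
  case (Suc k)
  show ?case
  proof (rule Ck_on_SucI[OF assms(1)])
    show "((\<lambda>x. f x + g x) has_derivative
        (\<lambda>v. frechet_derivative f (at x) v + frechet_derivative g (at x) v)) (at x)" if "x \<in> U" for x
      using Suc.prems that by (intro has_derivative_add) (auto simp: frechet_derivative_works[symmetric])
  qed (use Suc in auto)
qed

text \<open>
  The product rule expresses the derivative through the same bilinear map, applied to functions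
  which are one degree less smooth.
\<close>

lemma Ck_on_bilinear:
  assumes B: "bounded_bilinear B" and "open U" "Ck_on k U f" "Ck_on k U g"
  shows "Ck_on k U (\<lambda>x. B (f x) (g x))"
  using assms(3,4)
proof (induction k arbitrary: f g)
  case 0
  then show ?case by (simp add: bounded_bilinear.continuous_on[OF B])
next
  case (Suc k)
  show ?case
  proof (rule Ck_on_SucI[OF assms(2)])
    show "((\<lambda>x. B (f x) (g x)) has_derivative
        (\<lambda>v. B (f x) (frechet_derivative g (at x) v) + B (frechet_derivative f (at x) v) (g x))) (at x)"
      if "x \<in> U" for x
      using Suc.prems that
      by (intro bounded_bilinear.FDERIV[OF B]) (auto simp: frechet_derivative_works[symmetric])
    have "Ck_on k U f" "Ck_on k U g"
      using Suc.prems by (blast dest: Ck_on_SucD)+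
    then show "Ck_on k U (\<lambda>x. B (f x) (frechet_derivative g (at x) v)
        + B (frechet_derivative f (at x) v) (g x))" for v
      using Suc.prems by (intro Ck_on_add[OF assms(2)] Suc.IH) auto
  qed
qed

lemma Ck_on_linear_comp:
  assumes L: "bounded_linear L" and "open U" "Ck_on k U f"
  shows "Ck_on k U (\<lambda>x. L (f x))"
  using assms(3)
proof (induction k arbitrary: f)
  case 0
  then show ?case by (simp add: bounded_linear.continuous_on[OF L])
next
  case (Suc k)
  show ?case
  proof (rule Ck_on_SucI[OF assms(2)])
    show "((\<lambda>x. L (f x)) has_derivative (\<lambda>v. L (frechet_derivative f (at x) v))) (at x)" if "x \<in> U" for x
      using Suc.prems that
      by (intro bounded_linear.has_derivative[OF L]) (auto simp: frechet_derivative_works[symmetric])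
  qed (use Suc in auto)
qed

lemma matrix_mult_add_rdistrib: "(A + B) ** C = A ** C + B ** (C :: 'a::semiring_1^'n^'m)"
  by (vector matrix_matrix_mult_def sum.distrib distrib_right)

lemma bounded_bilinear_matrix_mult:
  "bounded_bilinear ((**) :: real^'n^'m \<Rightarrow> real^'p^'n \<Rightarrow> real^'p^'m)"
  unfolding bilinear_conv_bounded_bilinear[symmetric] bilinear_def
  by (auto intro!: linearI simp: matrix_add_ldistrib matrix_mult_add_rdistrib matrix_scalar_ac
      scalar_matrix_assoc[symmetric])

lemma norm_matrix_mult_bound:
  obtains K where "K > 0"
    "\<And>(X :: real^'n^'n) (Y :: real^'n^'n). norm (X ** Y) \<le> norm X * norm Y * K"
proof -
  have "\<exists>K>0. \<forall>(X :: real^'n^'n) (Y :: real^'n^'n). norm (X ** Y) \<le> norm X * norm Y * K"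
    by (rule bounded_bilinear.pos_bounded[OF bounded_bilinear_matrix_mult])
  then show thesis using that by blast
qed

lemma matrix_inv_mult:
  fixes A :: "real^'n^'n"
  assumes "invertible A"
  shows "A ** matrix_inv A = mat 1" "matrix_inv A ** A = mat 1"
  using someI_ex[OF assms[unfolded invertible_def]] unfolding matrix_inv_def by auto

lemma invertible_matrix_inv:
  fixes A :: "real^'n^'n"
  shows "invertible A \<Longrightarrow> invertible (matrix_inv A)"
  using matrix_inv_mult[of A] unfolding invertible_def by blast

lemma matrix_inv_unique:
  fixes A B :: "real^'n^'n"
  assumes "A ** B = mat 1"
  shows "matrix_inv A = B"
proof -
  have "invertible A" using assms matrix_left_right_inverse[of A B] unfolding invertible_def by blast
  then have "matrix_inv A ** (A ** B) = B"
    by (simp add: matrix_mul_assoc matrix_inv_mult)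
  then show ?thesis using assms by simp
qed

lemma open_invertible: "open {A :: real^'n^'n. invertible A}"
proof -
  have "continuous_on UNIV (det :: real^'n^'n \<Rightarrow> real)"
    unfolding det_def by (intro continuous_intros)
  then have "open ((det :: real^'n^'n \<Rightarrow> real) -` (- {0}))"
    by (rule open_vimage[rotated]) auto
  also have "(det :: real^'n^'n \<Rightarrow> real) -` (- {0}) = {A. invertible A}"
    by (auto simp: invertible_det_nz)
  finally show ?thesis .
qed

text \<open>
  The resolvent identity: it gives first the continuity of inversion and then its derivative.
\<close>

lemma matrix_inv_diff:
  fixes A B :: "real^'n^'n"
  assumes "invertible A" "invertible B"
  shows "matrix_inv B - matrix_inv A = - (matrix_inv B ** (B - A) ** matrix_inv A)"
proof -
  have "matrix_inv B ** (B - A) ** matrix_inv A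
      = matrix_inv B ** B ** matrix_inv A - matrix_inv B ** (A ** matrix_inv A)"
    by (simp add: bounded_bilinear.diff_left[OF bounded_bilinear_matrix_mult]
        bounded_bilinear.diff_right[OF bounded_bilinear_matrix_mult] matrix_mul_assoc)
  then show ?thesis using assms by (simp add: matrix_inv_mult)
qed

text \<open>
  The resolvent identity bounds the difference of the inverses by the norm of \<open>B\<^sup>-\<^sup>1\<close> times a small
  factor; once this factor is below \<open>1/2\<close>, the norm of \<open>B\<^sup>-\<^sup>1\<close> is at most twice that of \<open>A\<^sup>-\<^sup>1\<close>.
\<close>

lemma isCont_matrix_inv:
  fixes A :: "real^'n^'n"
  assumes A: "invertible A"
  shows "isCont matrix_inv A"
proof -
  interpret M: bounded_bilinear "(**) :: real^'n^'n \<Rightarrow> real^'n^'n \<Rightarrow> real^'n^'n"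
    by (rule bounded_bilinear_matrix_mult)
  obtain K where K: "K > 0" "\<And>(X :: real^'n^'n) (Y :: real^'n^'n). norm (X ** Y) \<le> norm X * norm Y * K"
    using norm_matrix_mult_bound[where 'n = 'n] by blast
  let ?a = "norm (matrix_inv A)"
  let ?c = "?a * K * K"
  have step: "norm (matrix_inv B - matrix_inv A) \<le> norm (matrix_inv B) * (?c * norm (B - A))"
    if "invertible B" for B
  proof -
    have "norm (matrix_inv B - matrix_inv A) \<le> norm (matrix_inv B ** (B - A)) * ?a * K"
      using K(2)[of "matrix_inv B ** (B - A)" "matrix_inv A"]
      by (simp add: matrix_inv_diff[OF A that])
    also have "\<dots> \<le> (norm (matrix_inv B) * norm (B - A) * K) * ?a * K"
      using K by (intro mult_right_mono) auto
    finally show ?thesis by (simp add: algebra_simps)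
  qed
  have sm: "((\<lambda>B. ?c * norm (B - A)) \<longlongrightarrow> 0) (at A)"
    by (rule tendsto_eq_intros | simp)+
  have ev1: "\<forall>\<^sub>F B in at A. ?c * norm (B - A) < 1 / 2"
    using order_tendstoD(2)[OF sm, of "1/2"] by simp
  have ev2: "\<forall>\<^sub>F B in at A. invertible B"
    using eventually_at_topological[of "\<lambda>B. invertible B" A UNIV] open_invertible A by blast
  have "\<forall>\<^sub>F B in at A. norm (matrix_inv B - matrix_inv A) \<le> 2 * ?a * (?c * norm (B - A))"
    using ev1 ev2
  proof eventually_elim
    case (elim B)
    have "norm (matrix_inv B) \<le> ?a + norm (matrix_inv B - matrix_inv A)"
      by (metis add.commute norm_triangle_sub)
    also have "\<dots> \<le> ?a + norm (matrix_inv B) * (?c * norm (B - A))"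
      using step elim by simp
    also have "\<dots> \<le> ?a + norm (matrix_inv B) * (1 / 2)"
      using elim by (intro add_left_mono mult_left_mono) auto
    finally have "norm (matrix_inv B) \<le> 2 * ?a" by simp
    then have "norm (matrix_inv B) * (?c * norm (B - A)) \<le> 2 * ?a * (?c * norm (B - A))"
      using K by (intro mult_right_mono) auto
    then show ?case using step[of B] elim by simp
  qed
  moreover have "((\<lambda>B. 2 * ?a * (?c * norm (B - A))) \<longlongrightarrow> 0) (at A)"
    using tendsto_mult_right_zero[OF sm] by simp
  ultimately have "((\<lambda>B. matrix_inv B - matrix_inv A) \<longlongrightarrow> 0) (at A)"
    by (rule Lim_null_comparison)
  then show ?thesis
    unfolding isCont_def by (simp add: LIM_zero_iff)
qed

text \<open>
  By the resolvent identity the remainder is \<open>(B\<^sup>-\<^sup>1 - A\<^sup>-\<^sup>1) (B - A) A\<^sup>-\<^sup>1\<close> up to sign, and its first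
  factor tends to \<open>0\<close> by continuity.
\<close>

lemma has_derivative_matrix_inv:
  fixes A :: "real^'n^'n"
  assumes A: "invertible A"
  shows "(matrix_inv has_derivative (\<lambda>V. - (matrix_inv A ** V ** matrix_inv A))) (at A)"
proof -
  interpret M: bounded_bilinear "(**) :: real^'n^'n \<Rightarrow> real^'n^'n \<Rightarrow> real^'n^'n"
    by (rule bounded_bilinear_matrix_mult)
  let ?L = "\<lambda>V. - (matrix_inv A ** V ** matrix_inv A)"
  obtain K where K: "K > 0" "\<And>(X :: real^'n^'n) (Y :: real^'n^'n). norm (X ** Y) \<le> norm X * norm Y * K"
    using norm_matrix_mult_bound[where 'n = 'n] by blast
  have L: "bounded_linear ?L"
    by (intro bounded_linear_minus bounded_linear_compose[OF M.bounded_linear_left]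
        M.bounded_linear_right)
  let ?e = "\<lambda>B. norm (matrix_inv B - matrix_inv A) * (norm (matrix_inv A) * K * K)"
  have "((\<lambda>B. matrix_inv B - matrix_inv A) \<longlongrightarrow> 0) (at A)"
    using isCont_matrix_inv[OF A] unfolding isCont_def by (simp add: LIM_zero_iff)
  then have e0: "(?e \<longlongrightarrow> 0) (at A)"
    by (intro tendsto_mult_left_zero tendsto_norm_zero)
  have ev: "\<forall>\<^sub>F B in at A. invertible B"
    using eventually_at_topological[of "\<lambda>B. invertible B" A UNIV] open_invertible A by blast
  have "\<forall>\<^sub>F B in at A. norm ((matrix_inv B - matrix_inv A - ?L (B - A)) /\<^sub>R norm (B - A)) \<le> ?e B"
    using ev
  proof eventually_elim
    case (elim B)
    have "matrix_inv B - matrix_inv A - ?L (B - A)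
        = - ((matrix_inv B - matrix_inv A) ** (B - A) ** matrix_inv A)"
      by (subst matrix_inv_diff[OF A elim]) (simp add: M.diff_left[of "matrix_inv B"] M.diff_left[of "matrix_inv B ** X" for X])
    also have "norm \<dots> \<le> norm ((matrix_inv B - matrix_inv A) ** (B - A)) * norm (matrix_inv A) * K"
      using K(2) by simp
    also have "\<dots> \<le> (norm (matrix_inv B - matrix_inv A) * norm (B - A) * K) * norm (matrix_inv A) * K"
      using K by (intro mult_right_mono) auto
    also have "\<dots> = ?e B * norm (B - A)" by simp
    finally have "norm (matrix_inv B - matrix_inv A - ?L (B - A)) \<le> ?e B * norm (B - A)" .
    moreover have "?e B \<ge> 0" using K by simp
    ultimately show ?case
      by (cases "B = A") (simp_all add: pos_divide_le_eq divide_inverse_commute[symmetric])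
  qed
  from Lim_null_comparison[OF this e0]
  show ?thesis
    unfolding has_derivative_def using L
    by (simp add: has_derivative_at_within netlimit_at Lim_ident_at)
qed

text \<open>
  The derivative of the inversion is a product of inversions and constants, so each degree of
  smoothness gives the next one.
\<close>

theorem smooth_on_matrix_inv: "smooth_on {A :: real^'n^'n. invertible A} matrix_inv"
proof -
  let ?U = "{A :: real^'n^'n. invertible A}"
  have "Ck_on k ?U matrix_inv" for k
  proof (induction k)
    case 0
    then show ?case
      by (auto intro!: continuous_at_imp_continuous_on isCont_matrix_inv)
  next
    case (Suc k)
    show ?case
    proof (rule Ck_on_SucI[OF open_invertible])
      show "Ck_on k ?U (\<lambda>A. - (matrix_inv A ** V ** matrix_inv A))" for V
        by (intro Ck_on_linear_comp[of uminus] bounded_linear_minus bounded_linear_ident open_invertible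
            Ck_on_bilinear[OF bounded_bilinear_matrix_mult] Suc Ck_on_const)
    qed (use has_derivative_matrix_inv in auto)
  qed
  then show ?thesis by (simp add: smooth_on_def open_invertible)
qed

section \<open>Matrix Lie groups and left invariant forms\<close>

lemma smooth_on_affine: "bounded_linear L \<Longrightarrow> open U \<Longrightarrow> smooth_on U (\<lambda>x. L x + c)"
  by (simp add: smooth_on_def Ck_on_add Ck_on_linear Ck_on_const)

lemma smooth_map_onI:
  assumes "smooth_on U g" "M \<subseteq> U" "\<And>x. x \<in> M \<Longrightarrow> g x = f x"
  shows "smooth_map_on M f"
  unfolding smooth_map_on_def using assms by blast

text \<open>
  The translation by \<open>- p\<close> is a global chart.
\<close>

lemma smooth_submanifold_open_affine:
  fixes S :: "'a::euclidean_space set"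
  assumes "open U" "subspace S"
  shows "smooth_submanifold (dim S) {x \<in> U. x - p \<in> S}"
  unfolding smooth_submanifold_def
proof
  fix x assume x: "x \<in> {x \<in> U. x - p \<in> S}"
  let ?\<phi> = "\<lambda>x. x + (- p)" and ?\<psi> = "\<lambda>x. x + p"
  let ?V = "?\<phi> ` U"
  have "open ?V" using open_translation[OF assms(1), of "- p"] by (simp add: add.commute)
  then have "smooth_on U ?\<phi>" "smooth_on ?V ?\<psi>"
    using assms(1) by (simp_all only: smooth_on_affine[OF bounded_linear_ident])
  moreover have "homeomorphism U ?V ?\<phi> ?\<psi>"
    unfolding homeomorphism_def by (auto intro!: continuous_intros simp: image_iff)
  moreover have "?\<phi> ` ({x \<in> U. x - p \<in> S} \<inter> U) = S \<inter> ?V"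
    by (auto simp: image_iff)
  ultimately show "\<exists>U' V \<phi> \<psi> S'. x \<in> U' \<and> smooth_on U' (\<phi> :: 'a \<Rightarrow> 'a) \<and> smooth_on V (\<psi> :: 'a \<Rightarrow> 'a) \<and>
      homeomorphism U' V \<phi> \<psi> \<and> subspace S' \<and> dim S' = dim S \<and> \<phi> ` ({x \<in> U. x - p \<in> S} \<inter> U') = S' \<inter> V"
    using x assms(2) by (intro exI[of _ U] exI[of _ ?V] exI[of _ ?\<phi>] exI[of _ ?\<psi>] exI[of _ S]) auto
qed

text \<open>
  Every \<open>v \<in> S\<close> is the velocity of a short segment through \<open>x\<close>. This
  supplies the tangent vectors on which the top form of the contact condition is evaluated.
\<close>

lemma tangent_space_open_linear:
  fixes S :: "'a::euclidean_space set"
  assumes "open U" "subspace S" "x \<in> U" "x \<in> S" "v \<in> S"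
  shows "v \<in> tangent_space {x \<in> S. x \<in> U} x"
proof -
  let ?\<gamma> = "\<lambda>t. t *\<^sub>R v + x"
  have "open (?\<gamma> -` U)"
    using assms(1) by (intro open_vimage continuous_intros)
  moreover have "0 \<in> ?\<gamma> -` U" using assms(3) by simp
  ultimately obtain e where e: "e > 0" "ball 0 e \<subseteq> ?\<gamma> -` U"
    by (meson open_contains_ball)
  have "smooth_curve_at {x \<in> S. x \<in> U} ?\<gamma> x v"
    unfolding smooth_curve_at_def
  proof (intro conjI exI[of _ e])
    show "smooth_on {- e<..<e} ?\<gamma>"
      by (rule smooth_on_affine) (auto intro: bounded_linear_scaleR_left)
    have "{- e<..<e} = ball 0 e" by (auto simp: dist_real_def)
    then have "?\<gamma> ` {- e<..<e} \<subseteq> U" using e(2) by blast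
    moreover have "?\<gamma> ` {- e<..<e} \<subseteq> S"
      using assms(2,4,5) by (auto intro: subspace_add subspace_scale)
    ultimately show "?\<gamma> ` {- e<..<e} \<subseteq> {x \<in> S. x \<in> U}" by blast
    show "(?\<gamma> has_vector_derivative v) (at 0)"
      by (auto intro!: derivative_eq_intros)
  qed (use e in auto)
  then show ?thesis by (auto simp: tangent_space_def)
qed

lemma GL_simps [simp]:
  "carrier GL = {A. invertible A}" "A \<otimes>\<^bsub>GL\<^esub> B = A ** B" "\<one>\<^bsub>GL\<^esub> = mat 1"
  by (simp_all add: GL_def)

lemma group_GL: "group (GL :: (real^'n^'n) monoid)"
proof (rule groupI)
  fix A :: "real^'n^'n" assume "A \<in> carrier GL"
  then show "\<exists>B\<in>carrier GL. B \<otimes>\<^bsub>GL\<^esub> A = \<one>\<^bsub>GL\<^esub>"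
    by (intro bexI[of _ "matrix_inv A"]) (auto simp: matrix_inv_mult invertible_matrix_inv)
next
  show "\<one>\<^bsub>GL\<^esub> \<in> carrier (GL :: (real^'n^'n) monoid)"
    by (auto simp: invertible_def intro: exI[of _ "mat 1"])
qed (auto simp: invertible_mult matrix_mul_assoc)

lemma m_inv_GL:
  assumes "invertible (A :: real^'n^'n)"
  shows "m_inv GL A = matrix_inv A"
  using assms by (intro group.inv_equality[OF group_GL])
    (auto simp: matrix_inv_mult invertible_matrix_inv)

text \<open>
  Affine subspaces not through \<open>0\<close> occur for the subgroup isomorphic to the affine group, which
  lies in a translate through the identity matrix.
\<close>

theorem lie_group_affine_subgroup_GL:
  fixes N S :: "(real^'n^'n) set"
  assumes N: "subgroup N GL" and S: "subspace S" and N_eq: "N = {A. invertible A \<and> A - P \<in> S}"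
  shows "lie_group (dim S) (GL\<lparr>carrier := N\<rparr>)"
proof -
  have inv: "invertible A" if "A \<in> N" for A using that N_eq by simp
  have "smooth_submanifold (dim S) N"
    using smooth_submanifold_open_affine[OF open_invertible S, of P] by (simp add: N_eq)
  moreover have "smooth_map_on (N \<times> N) (\<lambda>(A, B). A \<otimes>\<^bsub>GL\<^esub> B)"
  proof (rule smooth_map_onI)
    show "smooth_on UNIV (\<lambda>z :: (real^'n^'n) \<times> (real^'n^'n). fst z ** snd z)"
      unfolding smooth_on_def
      by (intro conjI allI open_UNIV Ck_on_bilinear[OF bounded_bilinear_matrix_mult]
          Ck_on_linear[OF bounded_linear_fst] Ck_on_linear[OF bounded_linear_snd])
  qed auto
  moreover have "smooth_map_on N (m_inv (GL\<lparr>carrier := N\<rparr>))"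
  proof (rule smooth_map_onI[OF smooth_on_matrix_inv])
    show "N \<subseteq> {A. invertible A}" using inv by auto
    show "matrix_inv A = m_inv (GL\<lparr>carrier := N\<rparr>) A" if "A \<in> N" for A
      using group.m_inv_consistent[OF group_GL N that] m_inv_GL[OF inv[OF that]] by simp
  qed
  ultimately show ?thesis
    unfolding lie_group_def using subgroup.subgroup_is_group[OF N group_GL]
    by (simp del: GL_simps(2))
qed

lemma matrix_inv_matrix_mult:
  fixes A B :: "real^'n^'n"
  assumes "invertible A" "invertible B"
  shows "matrix_inv (A ** B) = matrix_inv B ** matrix_inv A"
proof (rule matrix_inv_unique)
  have "A ** B ** (matrix_inv B ** matrix_inv A) = A ** (B ** matrix_inv B) ** matrix_inv A"
    by (simp only: matrix_mul_assoc)
  then show "A ** B ** (matrix_inv B ** matrix_inv A) = mat 1"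
    using assms by (simp add: matrix_inv_mult)
qed

definition left_invariant_form :: "(real^'n^'n \<Rightarrow> real) \<Rightarrow> real^'n^'n \<Rightarrow> real^'n^'n \<Rightarrow> real" where
  "left_invariant_form f A V = f (matrix_inv A ** V)"

lemma left_invariant_left_invariant_form:
  assumes "N \<subseteq> {A. invertible A}"
  shows "left_invariant (GL\<lparr>carrier := N\<rparr>) (left_invariant_form f)"
  unfolding left_invariant_def
proof (intro ballI allI impI)
  fix g h \<gamma> v w
  assume gh: "g \<in> carrier (GL\<lparr>carrier := N\<rparr>)" "h \<in> carrier (GL\<lparr>carrier := N\<rparr>)"
    and "smooth_curve_at (carrier (GL\<lparr>carrier := N\<rparr>)) \<gamma> h v"
    and "smooth_curve_at (carrier (GL\<lparr>carrier := N\<rparr>)) (\<lambda>t. g \<otimes>\<^bsub>GL\<lparr>carrier := N\<rparr>\<^esub> \<gamma> t)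
           (g \<otimes>\<^bsub>GL\<lparr>carrier := N\<rparr>\<^esub> h) w"
  then have v: "(\<gamma> has_vector_derivative v) (at 0)"
    and w: "((\<lambda>t. g ** \<gamma> t) has_vector_derivative w) (at 0)"
    by (auto simp: smooth_curve_at_def)
  have "((\<lambda>t. g ** \<gamma> t) has_vector_derivative g ** v) (at 0)"
    by (rule bounded_linear.has_vector_derivative[OF
          bounded_bilinear.bounded_linear_right[OF bounded_bilinear_matrix_mult] v])
  with w have w: "w = g ** v" by (rule vector_derivative_unique_at)
  have "matrix_inv (g ** h) = matrix_inv h ** matrix_inv g"
    using gh assms by (intro matrix_inv_matrix_mult) auto
  then have "matrix_inv (g ** h) ** (g ** v) = matrix_inv h ** (matrix_inv g ** g) ** v"
    by (simp only: matrix_mul_assoc)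
  also have "\<dots> = matrix_inv h ** v"
    using gh assms by (auto simp: matrix_inv_mult)
  finally show "left_invariant_form f (g \<otimes>\<^bsub>GL\<lparr>carrier := N\<rparr>\<^esub> h) w = left_invariant_form f h v"
    by (simp add: w left_invariant_form_def)
qed

lemma extends_left_invariant_form:
  fixes f :: "real^'n^'n \<Rightarrow> real"
  assumes f: "linear f"
  shows "extends_one_form N (left_invariant_form f) {A. invertible A} (left_invariant_form f)"
proof -
  note M = bounded_bilinear_matrix_mult[where 'n = 'n and 'm = 'n and 'p = 'n]
  have "linear (left_invariant_form f A)" for A
    unfolding left_invariant_form_def
    using linear_compose[OF bounded_linear.linear[OF bounded_bilinear.bounded_linear_right[OF M]] f]
    by (simp add: comp_def)
  moreover have "smooth_on {A. invertible A} (\<lambda>A. left_invariant_form f A V)" for V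
    unfolding left_invariant_form_def smooth_on_def
    using smooth_on_matrix_inv[where 'n = 'n]
    by (auto simp: smooth_on_def intro!: Ck_on_linear_comp[OF linear_conv_bounded_linear[THEN iffD1, OF f]]
        Ck_on_bilinear[OF M] Ck_on_const)
  ultimately show ?thesis by (simp add: extends_one_form_def)
qed

lemma frechet_derivative_left_invariant_form:
  fixes f :: "real^'n^'n \<Rightarrow> real"
  assumes f: "linear f" and A: "invertible A"
  shows "frechet_derivative (\<lambda>A. left_invariant_form f A V) (at A) (A ** X)
    = - f (X ** matrix_inv A ** V)"
proof -
  note M = bounded_bilinear_matrix_mult[where 'n = 'n and 'm = 'n and 'p = 'n]
  have "((\<lambda>A. f (matrix_inv A ** V)) has_derivative
      (\<lambda>U. f (- (matrix_inv A ** U ** matrix_inv A) ** V))) (at A)"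
    by (intro bounded_linear.has_derivative[OF linear_conv_bounded_linear[THEN iffD1, OF f]]
        bounded_linear.has_derivative[OF bounded_bilinear.bounded_linear_left[OF M]]
        has_derivative_matrix_inv A)
  from frechet_derivative_at[OF this, symmetric]
  have "frechet_derivative (\<lambda>A. left_invariant_form f A V) (at A) (A ** X)
      = f (- ((matrix_inv A ** A) ** X ** matrix_inv A) ** V)"
    unfolding left_invariant_form_def by (simp add: matrix_mul_assoc)
  also have "\<dots> = - f (X ** matrix_inv A ** V)"
    using A by (simp add: matrix_inv_mult bounded_bilinear.minus_left[OF M] linear_neg[OF f])
  finally show ?thesis .
qed

definition matrix_subalgebra :: "(real^'n^'n) set \<Rightarrow> bool" where
  "matrix_subalgebra S \<longleftrightarrow> subspace S \<and> mat 1 \<in> S \<and> (\<forall>A\<in>S. \<forall>B\<in>S. A ** B \<in> S)"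

definition units_of_subalgebra :: "(real^'n^'n) set \<Rightarrow> (real^'n^'n) set" where
  "units_of_subalgebra S = {A \<in> S. invertible A}"

text \<open>
  Inverses stay in \<open>S\<close> because left multiplication by an invertible element of \<open>S\<close> is an injective
  linear map from the finite dimensional space \<open>S\<close> to itself, hence attains the identity matrix.
\<close>

theorem subgroup_units_of_subalgebra:
  fixes S :: "(real^'n^'n) set"
  assumes S: "matrix_subalgebra S"
  shows "subgroup (units_of_subalgebra S) GL"
proof
  fix A B assume "A \<in> units_of_subalgebra S" "B \<in> units_of_subalgebra S"
  then show "A \<otimes>\<^bsub>GL\<^esub> B \<in> units_of_subalgebra S"
    using S by (auto simp: units_of_subalgebra_def matrix_subalgebra_def invertible_mult)
next
  show "\<one>\<^bsub>GL\<^esub> \<in> units_of_subalgebra S"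
    using S by (auto simp: units_of_subalgebra_def matrix_subalgebra_def invertible_def
        intro: exI[of _ "mat 1"])
next
  fix A assume "A \<in> units_of_subalgebra S"
  then have A: "A \<in> S" "invertible A" by (auto simp: units_of_subalgebra_def)
  have L: "linear ((**) A)"
    by (rule bounded_linear.linear[OF bounded_bilinear.bounded_linear_right[OF bounded_bilinear_matrix_mult]])
  have "inj ((**) A)"
    by (rule inj_on_inverseI[of _ "(**) (matrix_inv A)"]) (simp add: matrix_mul_assoc matrix_inv_mult A)
  then have "dim ((**) A ` S) = dim S"
    by (intro dim_image_eq[OF L]) (auto intro: inj_on_subset)
  then have "(**) A ` S = S"
    using S A linear_subspace_image[OF L, of S]
    by (intro subspace_dim_equal) (auto simp: matrix_subalgebra_def)
  then have "mat 1 \<in> (**) A ` S" using S by (simp add: matrix_subalgebra_def)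
  then obtain B where "B \<in> S" "A ** B = mat 1" by (metis imageE)
  then have "matrix_inv A \<in> S" using matrix_inv_unique by metis
  then show "inv\<^bsub>GL\<^esub> A \<in> units_of_subalgebra S"
    using A by (simp add: m_inv_GL units_of_subalgebra_def invertible_matrix_inv)
qed (auto simp: units_of_subalgebra_def)

lemma lie_group_units_of_subalgebra:
  assumes "matrix_subalgebra S"
  shows "lie_group (dim S) (GL\<lparr>carrier := units_of_subalgebra S\<rparr>)"
  using assms by (intro lie_group_affine_subgroup_GL[where P = 0] subgroup_units_of_subalgebra)
    (auto simp: matrix_subalgebra_def units_of_subalgebra_def)

text \<open>
  The condition on \<open>f\<close> says that the radical of the Kirillov form \<open>f(X Y - Y X)\<close> on \<open>S\<close> consists of
  scalar matrices only.
\<close>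

definition contact_functional :: "(real^'n^'n) set \<Rightarrow> (real^'n^'n \<Rightarrow> real) \<Rightarrow> bool" where
  "contact_functional S f \<longleftrightarrow> linear f \<and> f (mat 1) \<noteq> 0 \<and>
     (\<forall>X\<in>S. (\<forall>Y\<in>S. f (X ** Y) = f (Y ** X)) \<longrightarrow> (\<exists>c. X = c *\<^sub>R mat 1))"

text \<open>
  The identity matrix commutes with everything, so an element of the kernel \<open>K\<close> of \<open>f\<close> in \<open>S\<close> that
  is orthogonal to \<open>K\<close> is orthogonal to \<open>S\<close>, hence scalar, hence zero because \<open>f 1 \<noteq> 0\<close>. So \<open>\<omega>\<close> is
  nondegenerate on \<open>K\<close>. Left translation by \<open>A\<close> carries \<open>\<omega>\<close> and \<open>f\<close> to \<open>d\<eta>\<close> and \<open>\<eta>\<close>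
  at \<open>A\<close>, so one basis of \<open>S\<close> serves all points.
\<close>

theorem contact_lie_group_units_of_subalgebra:
  fixes S :: "(real^'n^'n) set"
  assumes "matrix_subalgebra S" and "contact_functional S f"
  shows "contact_lie_group (GL\<lparr>carrier := units_of_subalgebra S\<rparr>)"
proof -
  define G where "G = units_of_subalgebra S"
  have G: "G = {A \<in> S. invertible A}" by (simp add: G_def units_of_subalgebra_def)
  have S: "subspace S" and one: "mat 1 \<in> S" and mult: "\<And>A B. A \<in> S \<Longrightarrow> B \<in> S \<Longrightarrow> A ** B \<in> S"
    using assms(1) by (auto simp: matrix_subalgebra_def)
  have f: "linear f" "f (mat 1) \<noteq> 0"
    and centre: "\<And>X. X \<in> S \<Longrightarrow> (\<And>Y. Y \<in> S \<Longrightarrow> f (X ** Y) = f (Y ** X)) \<Longrightarrow> \<exists>c. X = c *\<^sub>R mat 1"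
    using assms(2) by (auto simp: contact_functional_def)
  note M = bounded_bilinear_matrix_mult[where 'n = 'n and 'm = 'n and 'p = 'n]
  note lin = linear_add[OF f(1)] linear_diff[OF f(1)] linear_scale[OF f(1)] linear_0[OF f(1)]
  note bil = bounded_bilinear.add_left[OF M] bounded_bilinear.add_right[OF M]
    bounded_bilinear.diff_left[OF M] bounded_bilinear.diff_right[OF M]
    bounded_bilinear.scaleR_left[OF M] bounded_bilinear.scaleR_right[OF M]
  define \<omega> where "\<omega> X Y = f (Y ** X) - f (X ** Y)" for X Y
  define K where "K = {X \<in> S. f X = 0}"
  have K: "subspace K"
    using S unfolding K_def subspace_def by (auto simp: lin)
  have \<omega>: "bilinear \<omega>"
    unfolding bilinear_def \<omega>_def by (auto intro!: linearI simp: lin bil algebra_simps)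
  \<comment> \<open>The projection of \<open>S\<close> to \<open>K\<close> along the scalar matrices.\<close>
  define \<pi> where "\<pi> Y = Y - (f Y / f (mat 1)) *\<^sub>R mat 1" for Y
  have \<pi>: "\<pi> Y \<in> K" if "Y \<in> S" for Y
    using that S one f(2) unfolding K_def \<pi>_def
    by (auto simp: lin intro!: subspace_diff subspace_scale)
  have \<pi>_decomp: "Y = \<pi> Y + (f Y / f (mat 1)) *\<^sub>R mat 1" for Y
    by (simp add: \<pi>_def)
  have "X = 0" if X: "X \<in> K" "\<And>Y. Y \<in> K \<Longrightarrow> \<omega> X Y = 0" for X
  proof -
    have "f (X ** Y) = f (Y ** X)" if "Y \<in> S" for Y
      using X(2)[OF \<pi>[OF that]] by (simp add: \<omega>_def \<pi>_def lin bil)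
    then obtain c where c: "X = c *\<^sub>R mat 1" using centre X(1) by (auto simp: K_def)
    then have "c = 0" using X(1) f(2) by (simp add: K_def lin)
    then show ?thesis using c by simp
  qed
  then obtain k v where dimK: "dim K = 2 * k" and v: "range v \<subseteq> K" "symplectic_sequence \<omega> k v"
    using symplectic_basis_exists[OF K \<omega>] by (auto simp: \<omega>_def)
  have vK: "v i \<in> K" for i using v(1) by auto
  have "S = span (insert (mat 1) K)"
  proof
    show "span (insert (mat 1) K) \<subseteq> S"
      by (rule span_minimal) (use S one in \<open>auto simp: K_def\<close>)
    show "S \<subseteq> span (insert (mat 1) K)"
    proof
      fix Y assume "Y \<in> S"
      then have "\<pi> Y + (f Y / f (mat 1)) *\<^sub>R mat 1 \<in> span (insert (mat 1) K)"
        using \<pi> by (intro span_add span_scale span_base) auto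
      then show "Y \<in> span (insert (mat 1) K)" using \<pi>_decomp by simp
    qed
  qed
  moreover have "mat 1 \<notin> span K"
    using K f(2) by (simp add: span_eq_iff[THEN iffD2] K_def)
  ultimately have dimS: "dim S = 2 * k + 1"
    using dimK by (simp add: dim_insert)
  have lie: "lie_group (2 * k + 1) (GL\<lparr>carrier := G\<rparr>)"
    using lie_group_units_of_subalgebra[OF assms(1)] dimS by (simp add: G_def)
  let ?\<eta> = "left_invariant_form f"
  define \<Omega> where "\<Omega> A U V = frechet_derivative (\<lambda>x. ?\<eta> x V) (at A) U
      - frechet_derivative (\<lambda>x. ?\<eta> x U) (at A) V" for A U V
  have inv: "invertible A" if "A \<in> G" for A using that G by simp
  have "smooth_one_form G ?\<eta>" and "is_exterior_derivative G ?\<eta> \<Omega>"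
    unfolding smooth_one_form_def is_exterior_derivative_def \<Omega>_def
    using extends_left_invariant_form[OF f(1)] inv by blast+
  moreover have "\<exists>w. range w \<subseteq> tangent_space G A \<and>
      wedge (2 * k) 1 (wedge_power 2 (\<lambda>u. \<Omega> A (u 0) (u 1)) k) (\<lambda>u. ?\<eta> A (u 0)) w \<noteq> 0"
    if A: "A \<in> G" for A
  proof -
    define e where "e i = (if i < 2 * k then v i else mat 1)" for i
    let ?w = "\<lambda>i. A ** e i"
    have cancel: "X ** matrix_inv A ** (A ** Y) = X ** Y" "matrix_inv A ** (A ** Y) = Y" for X Y
    proof -
      have "X ** matrix_inv A ** (A ** Y) = X ** (matrix_inv A ** A) ** Y"
        and "matrix_inv A ** (A ** Y) = (matrix_inv A ** A) ** Y"
        by (simp_all only: matrix_mul_assoc)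
      then show "X ** matrix_inv A ** (A ** Y) = X ** Y" "matrix_inv A ** (A ** Y) = Y"
        by (simp_all add: matrix_inv_mult inv[OF A])
    qed
    have "?w i \<in> S" for i
      using A G vK one by (intro mult) (auto simp: e_def K_def)
    then have "range ?w \<subseteq> tangent_space G A"
      using tangent_space_open_linear[OF open_invertible S, of A] A unfolding G by auto
    moreover have \<Omega>: "\<Omega> A (A ** X) (A ** Y) = \<omega> X Y" for X Y
      unfolding \<Omega>_def \<omega>_def
      by (simp add: frechet_derivative_left_invariant_form[OF f(1) inv[OF A]] cancel)
    have "symplectic_sequence (\<Omega> A) k ?w"
      using v(2) unfolding symplectic_sequence_def \<Omega> by (simp add: e_def)
    then have "wedge (2 * k) 1 (wedge_power 2 (\<lambda>u. \<Omega> A (u 0) (u 1)) k) (\<lambda>u. ?\<eta> A (u 0)) ?w \<noteq> 0"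
    proof (rule wedge_power_wedge_symplectic_nonzero)
      show "?\<eta> A (?w i) = 0" if "i < 2 * k" for i
        using that vK[of i] by (simp add: left_invariant_form_def cancel e_def K_def)
      show "?\<eta> A (?w (2 * k)) \<noteq> 0"
        using f(2) by (simp add: left_invariant_form_def e_def matrix_inv_mult inv[OF A])
    qed
    ultimately show ?thesis by blast
  qed
  ultimately have "contact_form_on k G ?\<eta>"
    unfolding contact_form_on_def by blast
  moreover have "left_invariant (GL\<lparr>carrier := G\<rparr>) ?\<eta>"
    by (rule left_invariant_left_invariant_form) (use inv in auto)
  ultimately show ?thesis
    unfolding contact_lie_group_def G_def[symmetric] using lie by (auto intro!: exI[of _ k])
qed

section \<open>Contact functionals on stabilizer algebras\<close>

definition eigenvector_algebra :: "real^'n \<Rightarrow> (real^'n^'n) set" where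
  "eigenvector_algebra v = {A. \<exists>c. A *v v = c *\<^sub>R v}"

lemma matrix_subalgebra_eigenvector_algebra: "matrix_subalgebra (eigenvector_algebra v)"
  unfolding matrix_subalgebra_def
proof (intro conjI ballI)
  show "subspace (eigenvector_algebra v)"
    unfolding subspace_def eigenvector_algebra_def
  proof (safe, goal_cases)
    case 1
    then show ?case by (intro exI[of _ 0]) simp
  next
    case (2 A B a b)
    then show ?case by (intro exI[of _ "a + b"]) (simp add: matrix_vector_mult_add_rdistrib scaleR_add_left)
  next
    case (3 c A a)
    then show ?case by (intro exI[of _ "c * a"]) (simp add: scaleR_matrix_vector_assoc[symmetric])
  qed
  show "mat 1 \<in> eigenvector_algebra v"
    by (auto simp: eigenvector_algebra_def intro: exI[of _ 1])
  fix A B assume "A \<in> eigenvector_algebra v" "B \<in> eigenvector_algebra v"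
  then obtain a b where "A *v v = a *\<^sub>R v" "B *v v = b *\<^sub>R v"
    by (auto simp: eigenvector_algebra_def)
  then have "(A ** B) *v v = (b * a) *\<^sub>R v"
    by (simp add: matrix_vector_mul_assoc[symmetric] matrix_vector_mult_scaleR)
  then show "A ** B \<in> eigenvector_algebra v" by (auto simp: eigenvector_algebra_def)
qed

lemma eigenvector_subgroup_eq: "eigenvector_subgroup v = units_of_subalgebra (eigenvector_algebra v)"
  by (auto simp: eigenvector_subgroup_def units_of_subalgebra_def eigenvector_algebra_def)

definition matrix_unit :: "'n \<Rightarrow> 'n \<Rightarrow> real^'n^'n" where
  "matrix_unit a b = (\<chi> i j. if i = a \<and> j = b then 1 else 0)"

lemma matrix_unit_mult:
  "(X ** matrix_unit a b) $ i $ j = (if j = b then X $ i $ a else 0)"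
  "(matrix_unit a b ** X) $ i $ j = (if i = a then X $ b $ j else 0)"
proof -
  have "(X ** matrix_unit a b) $ i $ j = (\<Sum>k\<in>UNIV. if k = a then (if j = b then X $ i $ k else 0) else 0)"
    unfolding matrix_unit_def matrix_matrix_mult_def vec_lambda_beta by (intro sum.cong refl) simp
  then show "(X ** matrix_unit a b) $ i $ j = (if j = b then X $ i $ a else 0)" by simp
  have "(matrix_unit a b ** X) $ i $ j = (\<Sum>k\<in>UNIV. if k = b then (if i = a then X $ k $ j else 0) else 0)"
    unfolding matrix_unit_def matrix_matrix_mult_def vec_lambda_beta by (intro sum.cong refl) simp
  then show "(matrix_unit a b ** X) $ i $ j = (if i = a then X $ b $ j else 0)" by simp
qed

lemma eigenvector_algebra_axis:
  "A \<in> eigenvector_algebra (axis r 1) \<longleftrightarrow> (\<forall>i. i \<noteq> r \<longrightarrow> A $ i $ r = 0)"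
proof -
  have col: "(A *v axis r 1) $ i = A $ i $ r" for i
    by (simp add: matrix_vector_mult_basis column_def)
  have "A *v axis r 1 = c *\<^sub>R axis r 1 \<longleftrightarrow> A $ r $ r = c \<and> (\<forall>i. i \<noteq> r \<longrightarrow> A $ i $ r = 0)" for c
    unfolding vec_eq_iff col by (auto simp: axis_def)
  then show ?thesis by (simp add: eigenvector_algebra_def)
qed

text \<open>
  The algebra consists of the matrices whose column \<open>r\<close> vanishes off the diagonal. Take
  \<open>f A = tr (M A)\<close> where \<open>M\<close> is the sum of a diagonal matrix with distinct entries \<open>\<mu>\<^sub>i\<close> and the matrix
  with column \<open>r\<close> filled with ones. If \<open>X\<close> is in the radical, testing with the matrix units
  \<open>E\<^sub>a\<^sub>b\<close> for \<open>b \<noteq> r\<close> gives, in this order: the row \<open>r\<close> of \<open>X\<close> vanishes off the diagonal (\<open>a = b\<close>);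
  the other off-diagonal entries vanish, since the \<open>\<mu>\<^sub>i\<close> are distinct (\<open>a \<noteq> b\<close> and \<open>a \<noteq> r\<close>); all
  diagonal entries agree (\<open>a = r\<close>).
\<close>

lemma contact_functional_axis:
  fixes r :: "'n::finite"
  shows "\<exists>f. contact_functional (eigenvector_algebra (axis r 1)) f"
proof -
  \<comment> \<open>Distinct numbers for the \<open>\<mu>\<^sub>i\<close>, chosen positive so that the trace of \<open>M\<close> is nonzero.\<close>
  define \<mu> :: "'n \<Rightarrow> real" where "\<mu> i = 1 + real (to_nat i)" for i
  have \<mu>: "\<mu> i > 0" "\<mu> i = \<mu> j \<longleftrightarrow> i = j" for i j
    by (simp_all add: \<mu>_def)
  define f :: "real^'n^'n \<Rightarrow> real" where "f A = (\<Sum>i\<in>UNIV. \<mu> i * A $ i $ i) + (\<Sum>i\<in>UNIV. A $ r $ i)" for A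
  have "linear f"
    unfolding f_def by (rule linearI) (simp_all add: sum.distrib sum_distrib_left algebra_simps)
  moreover have "f (mat 1) \<noteq> 0"
  proof -
    have "(\<Sum>i\<in>UNIV. \<mu> i) > 0" using \<mu>(1) by (intro sum_pos) auto
    then show ?thesis by (simp add: f_def mat_def)
  qed
  moreover have "\<exists>c. X = c *\<^sub>R mat 1"
    if X: "X \<in> eigenvector_algebra (axis r 1)"
      and c: "\<And>Y. Y \<in> eigenvector_algebra (axis r 1) \<Longrightarrow> f (X ** Y) = f (Y ** X)" for X
  proof -
    have Xo: "X $ i $ r = 0" if "i \<noteq> r" for i using X that by (simp add: eigenvector_algebra_axis)
    have eq: "\<mu> b * X $ b $ a + X $ r $ a = \<mu> a * X $ b $ a + (if a = r then \<Sum>j\<in>UNIV. X $ b $ j else 0)"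
      if "b \<noteq> r" for a b
    proof -
      have "matrix_unit a b \<in> eigenvector_algebra (axis r 1)"
        using that by (simp add: eigenvector_algebra_axis matrix_unit_def)
      from c[OF this] show ?thesis
        by (simp add: f_def matrix_unit_mult if_distrib[of "\<lambda>x. _ * x"] cong: if_cong)
    qed
    have row: "X $ r $ b = 0" if "b \<noteq> r" for b
      using eq[of b b] that by simp
    have off: "X $ b $ a = 0" if "a \<noteq> b" for a b
    proof (cases "a = r \<or> b = r")
      case True
      then show ?thesis using that Xo row by metis
    next
      case False
      then have "\<mu> b * X $ b $ a = \<mu> a * X $ b $ a"
        using eq[of b a] row[of a] by simp
      then show ?thesis using \<mu>(2)[of a b] that by simp
    qed
    have diag: "X $ b $ b = X $ r $ r" for b
    proof (cases "b = r")
      case False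
      have "(\<Sum>j\<in>UNIV. X $ b $ j) = (\<Sum>j\<in>UNIV. if j = b then X $ b $ b else 0)"
        by (rule sum.cong) (auto simp: off)
      then show ?thesis using eq[OF False, of r] Xo[OF False] by simp
    qed simp
    have entry: "X $ i $ j = (X $ r $ r *\<^sub>R mat 1) $ i $ j" for i j
      using off[of j i] diag[of i] by (cases "i = j") (simp_all add: mat_def)
    have "X = X $ r $ r *\<^sub>R mat 1"
      by (intro vec_eq_iff[THEN iffD2] allI entry)
    then show ?thesis by blast
  qed
  ultimately show ?thesis unfolding contact_functional_def by blast
qed

text \<open>
  Conjugation is an algebra isomorphism from \<open>T\<close> to \<open>S\<close> which fixes the scalar matrices.
\<close>

lemma contact_functional_conjugate:
  fixes P Q :: "real^'n^'n"
  assumes PQ: "P ** Q = mat 1" "Q ** P = mat 1"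
    and f: "contact_functional S f" and T: "\<And>A. A \<in> T \<longleftrightarrow> P ** A ** Q \<in> S"
  shows "contact_functional T (\<lambda>A. f (P ** A ** Q))"
proof -
  note M = bounded_bilinear_matrix_mult[where 'n = 'n and 'm = 'n and 'p = 'n]
  have f1: "linear f" "f (mat 1) \<noteq> 0" using f by (auto simp: contact_functional_def)
  have "linear (\<lambda>A. P ** A ** Q)"
    by (rule bounded_linear.linear, rule bounded_linear_compose[OF bounded_bilinear.bounded_linear_left[OF M]
          bounded_bilinear.bounded_linear_right[OF M]])
  then have "linear (\<lambda>A. f (P ** A ** Q))"
    using linear_compose[OF _ f1(1)] by (simp add: comp_def)
  moreover have "f (P ** mat 1 ** Q) \<noteq> 0" using f1 PQ by simp
  moreover have conj: "P ** (A ** B) ** Q = (P ** A ** Q) ** (P ** B ** Q)" for A B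
  proof -
    have "(P ** A ** Q) ** (P ** B ** Q) = P ** A ** (Q ** P) ** B ** Q"
      by (simp only: matrix_mul_assoc)
    then show ?thesis by (simp add: PQ matrix_mul_assoc)
  qed
  have cancel: "P ** (Q ** A ** P) ** Q = A" "Q ** (P ** A ** Q) ** P = A" for A
  proof -
    have "P ** (Q ** A ** P) ** Q = (P ** Q) ** A ** (P ** Q)"
      and "Q ** (P ** A ** Q) ** P = (Q ** P) ** A ** (Q ** P)"
      by (simp_all only: matrix_mul_assoc)
    then show "P ** (Q ** A ** P) ** Q = A" "Q ** (P ** A ** Q) ** P = A" by (simp_all add: PQ)
  qed
  have "\<exists>c. X = c *\<^sub>R mat 1"
    if X: "X \<in> T" "\<forall>Y\<in>T. f (P ** (X ** Y) ** Q) = f (P ** (Y ** X) ** Q)" for X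
  proof -
    have "f ((P ** X ** Q) ** Y) = f (Y ** (P ** X ** Q))" if "Y \<in> S" for Y
    proof -
      have "Q ** Y ** P \<in> T" using that by (simp only: T cancel)
      then have "f (P ** (X ** (Q ** Y ** P)) ** Q) = f (P ** ((Q ** Y ** P) ** X) ** Q)"
        using X(2) by blast
      then show ?thesis
        by (simp only: conj[of X "Q ** Y ** P"] conj[of "Q ** Y ** P" X] cancel(1))
    qed
    then obtain c where "P ** X ** Q = c *\<^sub>R mat 1"
      using f X(1) unfolding contact_functional_def T by blast
    then have "Q ** (c *\<^sub>R mat 1) ** P = X" using cancel(2)[of X] by simp
    then have "X = c *\<^sub>R mat 1"
      by (simp add: bounded_bilinear.scaleR_left[OF M] bounded_bilinear.scaleR_right[OF M] PQ)
    then show ?thesis by blast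
  qed
  ultimately show ?thesis unfolding contact_functional_def by blast
qed

text \<open>
  Transposition reverses products, which only changes the sign of the Kirillov form.
\<close>

lemma contact_functional_transpose:
  fixes S :: "(real^'n^'n) set"
  assumes f: "contact_functional S f"
  shows "contact_functional (transpose ` S) (\<lambda>A. f (transpose A))"
proof -
  have f1: "linear f" "f (mat 1) \<noteq> 0" using f by (auto simp: contact_functional_def)
  have "linear (transpose :: real^'n^'n \<Rightarrow> real^'n^'n)"
    by (rule linearI) (simp_all add: transpose_def vec_eq_iff)
  then have "linear (\<lambda>A. f (transpose A))"
    using linear_compose[OF _ f1(1)] by (simp add: comp_def)
  moreover have "\<exists>c. transpose X = c *\<^sub>R mat 1"
    if X: "X \<in> S" "\<forall>Y\<in>S. f (transpose (transpose X ** transpose Y)) = f (transpose (transpose Y ** transpose X))" for X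
  proof -
    have "\<forall>Y\<in>S. f (X ** Y) = f (Y ** X)"
      using X(2) by (simp add: matrix_transpose_mul)
    then obtain c where "X = c *\<^sub>R mat 1" using f X(1) unfolding contact_functional_def by blast
    then have "transpose X = c *\<^sub>R mat 1" by (simp add: transpose_scalar)
    then show ?thesis by blast
  qed
  ultimately show ?thesis using f1(2) by (simp add: contact_functional_def)
qed

text \<open>
  Having \<open>v\<close> as an eigenvector only depends on the line of \<open>v\<close>, and an orthogonal matrix moves a
  coordinate axis to this line.
\<close>

lemma contact_functional_eigenvector_algebra:
  fixes v :: "real^'n"
  assumes "v \<noteq> 0"
  shows "\<exists>f. contact_functional (eigenvector_algebra v) f"
proof -
  fix r :: 'n
  obtain Q where Q: "orthogonal_matrix Q" "Q *v axis r 1 = v /\<^sub>R norm v"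
    using orthogonal_matrix_exists_basis[of "v /\<^sub>R norm v" r] assms by auto
  have PQ: "transpose Q ** Q = mat 1" "Q ** transpose Q = mat 1"
    using Q(1) by (auto simp: orthogonal_matrix_def)
  obtain f where f: "contact_functional (eigenvector_algebra (axis r 1)) f"
    using contact_functional_axis by blast
  have "A \<in> eigenvector_algebra v \<longleftrightarrow> transpose Q ** A ** Q \<in> eigenvector_algebra (axis r 1)" for A
  proof -
    have "(transpose Q ** A ** Q) *v axis r 1 = c *\<^sub>R axis r 1 \<longleftrightarrow> A *v v = c *\<^sub>R v" for c
    proof -
      have "(transpose Q ** A ** Q) *v axis r 1 = c *\<^sub>R axis r 1 \<longleftrightarrow>
          Q *v ((transpose Q ** A ** Q) *v axis r 1) = Q *v (c *\<^sub>R axis r 1)"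
        using PQ(1) by (metis matrix_vector_mul_assoc matrix_vector_mul_lid)
      also have "\<dots> \<longleftrightarrow> A *v (v /\<^sub>R norm v) = c *\<^sub>R (v /\<^sub>R norm v)"
        using PQ(2) Q(2) by (simp only: matrix_vector_mul_assoc matrix_mul_assoc matrix_vector_mult_scaleR
          matrix_mul_lid) (simp only: matrix_vector_mul_assoc[symmetric] Q(2) matrix_vector_mult_scaleR)
      also have "\<dots> \<longleftrightarrow> A *v v = c *\<^sub>R v"
        unfolding matrix_vector_mult_scaleR scaleR_left_commute[of c]
        using assms by (simp del: scaleR_scaleR)
      finally show ?thesis .
    qed
    then show ?thesis by (simp add: eigenvector_algebra_def)
  qed
  from contact_functional_conjugate[OF PQ f this] show ?thesis by blast
qed

theorem contact_lie_group_eigenvector_subgroup: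
  assumes "v \<noteq> 0"
  shows "contact_lie_group (GL\<lparr>carrier := eigenvector_subgroup v\<rparr>)"
  using contact_functional_eigenvector_algebra[OF assms] matrix_subalgebra_eigenvector_algebra
  unfolding eigenvector_subgroup_eq by (blast intro: contact_lie_group_units_of_subalgebra)

text \<open>
  With \<open>w\<close> normal to a hyperplane, these are the matrices that map the hyperplane into itself: the
  functional \<open>w \<bullet> A x\<close> vanishes there, so it is a multiple of \<open>w \<bullet> x\<close>.
\<close>

definition hyperplane_algebra :: "real^'n \<Rightarrow> (real^'n^'n) set" where
  "hyperplane_algebra w = {A. \<exists>c. \<forall>x. w \<bullet> (A *v x) = c * (w \<bullet> x)}"

lemma hyperplane_algebra_eq_transpose: "hyperplane_algebra w = transpose ` eigenvector_algebra w"
proof -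
  have "(\<forall>x. w \<bullet> (A *v x) = c * (w \<bullet> x)) \<longleftrightarrow> transpose A *v w = c *\<^sub>R w" for A c
  proof -
    have "w \<bullet> (A *v x) = c * (w \<bullet> x) \<longleftrightarrow> (transpose A *v w) \<bullet> x = (c *\<^sub>R w) \<bullet> x" for x
      by (simp add: dot_lmul_matrix)
    then show ?thesis by (metis vector_eq_rdot)
  qed
  then have mem: "A \<in> hyperplane_algebra w \<longleftrightarrow> transpose A \<in> eigenvector_algebra w" for A
    by (simp only: hyperplane_algebra_def eigenvector_algebra_def mem_Collect_eq)
  show ?thesis
  proof (intro subset_antisym subsetI)
    fix A assume "A \<in> hyperplane_algebra w"
    then have "transpose A \<in> eigenvector_algebra w" by (simp only: mem)
    then show "A \<in> transpose ` eigenvector_algebra w"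
      by (rule image_eqI[rotated]) (simp only: transpose_transpose)
  next
    fix A assume "A \<in> transpose ` eigenvector_algebra w"
    then obtain B where "A = transpose B" "B \<in> eigenvector_algebra w" by (rule imageE)
    then show "A \<in> hyperplane_algebra w" by (simp only: mem transpose_transpose)
  qed
qed

lemma matrix_subalgebra_hyperplane_algebra: "matrix_subalgebra (hyperplane_algebra w)"
  unfolding matrix_subalgebra_def
proof (intro conjI ballI)
  show "subspace (hyperplane_algebra w)"
    unfolding subspace_def hyperplane_algebra_def
  proof (safe, goal_cases)
    case 1
    then show ?case by (intro exI[of _ 0]) simp
  next
    case (2 A B a b)
    then show ?case
      by (intro exI[of _ "a + b"]) (simp add: matrix_vector_mult_add_rdistrib inner_add_right distrib_right)
  next
    case (3 c A a)
    then show ?case by (intro exI[of _ "c * a"]) (simp add: scaleR_matrix_vector_assoc[symmetric])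
  qed
  show "mat 1 \<in> hyperplane_algebra w"
    by (auto simp: hyperplane_algebra_def intro: exI[of _ 1])
  fix A B assume "A \<in> hyperplane_algebra w" "B \<in> hyperplane_algebra w"
  then obtain a b where "\<And>x. w \<bullet> (A *v x) = a * (w \<bullet> x)" "\<And>x. w \<bullet> (B *v x) = b * (w \<bullet> x)"
    by (auto simp: hyperplane_algebra_def)
  then show "A ** B \<in> hyperplane_algebra w"
    by (auto simp: hyperplane_algebra_def matrix_vector_mul_assoc[symmetric] intro: exI[of _ "a * b"])
qed

lemma linear_hyperplane_unit_normal:
  fixes H :: "(real^'n) set"
  assumes "linear_hyperplane H"
  obtains w where "w \<bullet> w = 1" "H = {x. w \<bullet> x = 0}"
proof -
  have H: "subspace H" "dim H = CARD('n) - 1" using assms by (auto simp: linear_hyperplane_def)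
  then obtain a where a: "a \<noteq> 0" "H \<subseteq> {x. a \<bullet> x = 0}"
    using lowdim_subset_hyperplane[of H] span_superset[of H] by auto
  then have "H = {x. a \<bullet> x = 0}"
    using H by (intro subspace_dim_equal) (auto simp: subspace_hyperplane dim_hyperplane)
  moreover define w where "w = a /\<^sub>R norm a"
  moreover have "w \<bullet> w = 1" using a(1) by (simp add: w_def dot_square_norm power2_eq_square)
  ultimately show thesis using a(1) by (intro that[of w]) auto
qed

text \<open>
  The factor \<open>c\<close> by which \<open>A\<close> multiplies the normal functional is \<open>w \<bullet> A w\<close>, as \<open>x - (w \<bullet> x) w\<close>
  lies in the hyperplane. For invertible \<open>A\<close> it is nonzero, so preimages of points of the hyperplane
  lie in the hyperplane too.
\<close>

lemma hyperplane_stabilizer_eq: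
  assumes w: "w \<bullet> w = 1"
  shows "hyperplane_stabilizer {x. w \<bullet> x = 0} = units_of_subalgebra (hyperplane_algebra w)"
proof (intro subset_antisym subsetI)
  fix A assume "A \<in> hyperplane_stabilizer {x. w \<bullet> x = 0}"
  then have A: "invertible A" "(\<lambda>x. A *v x) ` {x. w \<bullet> x = 0} = {x. w \<bullet> x = 0}"
    by (auto simp: hyperplane_stabilizer_def)
  have "w \<bullet> (A *v x) = w \<bullet> (A *v w) * (w \<bullet> x)" for x
  proof -
    have "w \<bullet> (x - (w \<bullet> x) *\<^sub>R w) = 0" using w by (simp add: inner_diff_right)
    then have "w \<bullet> (A *v (x - (w \<bullet> x) *\<^sub>R w)) = 0" using A(2) by blast
    then show ?thesis by (simp add: matrix_vector_mult_diff_distrib matrix_vector_mult_scaleR inner_diff_right)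
  qed
  then have "A \<in> hyperplane_algebra w" unfolding hyperplane_algebra_def by blast
  then show "A \<in> units_of_subalgebra (hyperplane_algebra w)"
    using A(1) by (simp add: units_of_subalgebra_def)
next
  fix A assume "A \<in> units_of_subalgebra (hyperplane_algebra w)"
  then obtain c where A: "invertible A" "\<And>x. w \<bullet> (A *v x) = c * (w \<bullet> x)"
    by (auto simp: units_of_subalgebra_def hyperplane_algebra_def)
  have inv: "A *v (matrix_inv A *v y) = y" for y
    using A(1) by (simp add: matrix_vector_mul_assoc matrix_inv_mult)
  have "c \<noteq> 0" using A(2)[of "matrix_inv A *v w"] w by (auto simp: inv)
  have "y \<in> (\<lambda>x. A *v x) ` {x. w \<bullet> x = 0}" if "w \<bullet> y = 0" for y
  proof (rule image_eqI)
    show "y = A *v (matrix_inv A *v y)" by (simp add: inv)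
    show "matrix_inv A *v y \<in> {x. w \<bullet> x = 0}"
      using A(2)[of "matrix_inv A *v y"] that \<open>c \<noteq> 0\<close> by (simp add: inv)
  qed
  then show "A \<in> hyperplane_stabilizer {x. w \<bullet> x = 0}"
    using A by (auto simp: hyperplane_stabilizer_def)
qed

theorem contact_lie_group_hyperplane_algebra:
  assumes "w \<noteq> 0"
  shows "contact_lie_group (GL\<lparr>carrier := units_of_subalgebra (hyperplane_algebra w)\<rparr>)"
proof -
  obtain f where "contact_functional (eigenvector_algebra w) f"
    using contact_functional_eigenvector_algebra[OF assms] by blast
  then show ?thesis
    using contact_lie_group_units_of_subalgebra[OF matrix_subalgebra_hyperplane_algebra]
      contact_functional_transpose hyperplane_algebra_eq_transpose by metis
qed

section \<open>The affine group inside the hyperplane stabilizer\<close>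

text \<open>
  The tangent space at the identity matrix of the group defined next.
\<close>

definition annihilated_by :: "real^'n \<Rightarrow> (real^'n^'n) set" where
  "annihilated_by w = {A. \<forall>x. w \<bullet> (A *v x) = 0}"

text \<open>
  Equivalently, the linear maps that preserve each affine hyperplane \<open>w \<bullet> x = t\<close>. On the one with
  \<open>t = 1\<close> they act as the affine group.
\<close>

definition functional_fixing_group :: "real^'n \<Rightarrow> (real^'n^'n) set" where
  "functional_fixing_group w = {A. invertible A \<and> (\<forall>x. w \<bullet> (A *v x) = w \<bullet> x)}"

lemma subspace_annihilated_by: "subspace (annihilated_by w)"
  by (auto simp: subspace_def annihilated_by_def matrix_vector_mult_add_rdistrib inner_add_right
      scaleR_matrix_vector_assoc[symmetric])

lemma functional_fixing_group_eq:
  "functional_fixing_group w = {A. invertible A \<and> A - mat 1 \<in> annihilated_by w}"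
  by (simp add: functional_fixing_group_def annihilated_by_def matrix_vector_mult_diff_rdistrib
      inner_diff_right)

text \<open>
  A matrix that multiplies the normal functional by \<open>c\<close> differs from \<open>c\<close> times the identity by a
  matrix that annihilates it.
\<close>

lemma dim_hyperplane_algebra:
  assumes w: "w \<bullet> w = 1"
  shows "dim (hyperplane_algebra w) = dim (annihilated_by w) + 1"
proof -
  have S: "subspace (hyperplane_algebra w)" and one: "mat 1 \<in> hyperplane_algebra w"
    using matrix_subalgebra_hyperplane_algebra[of w] by (simp_all add: matrix_subalgebra_def)
  have "hyperplane_algebra w = span (insert (mat 1) (annihilated_by w))"
  proof (rule subset_antisym)
    have "annihilated_by w \<subseteq> hyperplane_algebra w"
      by (auto simp: annihilated_by_def hyperplane_algebra_def intro: exI[of _ 0])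
    then show "span (insert (mat 1) (annihilated_by w)) \<subseteq> hyperplane_algebra w"
      using S one by (intro span_minimal) auto
    show "hyperplane_algebra w \<subseteq> span (insert (mat 1) (annihilated_by w))"
    proof
      fix A assume "A \<in> hyperplane_algebra w"
      then obtain c where "\<And>x. w \<bullet> (A *v x) = c * (w \<bullet> x)" by (auto simp: hyperplane_algebra_def)
      then have "A - c *\<^sub>R mat 1 \<in> annihilated_by w"
        by (simp add: annihilated_by_def matrix_vector_mult_diff_rdistrib inner_diff_right
            scaleR_matrix_vector_assoc[symmetric])
      then have "(A - c *\<^sub>R mat 1) + c *\<^sub>R mat 1 \<in> span (insert (mat 1) (annihilated_by w))"
        by (intro span_add span_scale span_base) auto
      then show "A \<in> span (insert (mat 1) (annihilated_by w))" by simp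
    qed
  qed
  moreover have "mat 1 \<notin> span (annihilated_by w)"
    unfolding span_eq_iff[THEN iffD2, OF subspace_annihilated_by]
    using w by (auto simp: annihilated_by_def intro: exI[of _ w])
  ultimately show ?thesis by (simp add: dim_insert)
qed

lemma matrix_inv_functional:
  fixes A :: "real^'n^'n"
  assumes A: "invertible A" and "\<And>x. w \<bullet> (A *v x) = c * (w \<bullet> x)"
  shows "c * (w \<bullet> (matrix_inv A *v x)) = w \<bullet> x"
proof -
  have "A *v (matrix_inv A *v x) = x"
    using A by (simp add: matrix_vector_mul_assoc matrix_inv_mult)
  then show ?thesis using assms(2)[of "matrix_inv A *v x"] by simp
qed

lemma subgroup_functional_fixing_group: "subgroup (functional_fixing_group w) GL"
proof
  fix A assume A: "A \<in> functional_fixing_group w"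
  then have "w \<bullet> (matrix_inv A *v x) = w \<bullet> x" for x
    using matrix_inv_functional[of A w 1] by (simp add: functional_fixing_group_def)
  then show "inv\<^bsub>GL\<^esub> A \<in> functional_fixing_group w"
    using A by (simp add: functional_fixing_group_def m_inv_GL invertible_matrix_inv)
qed (auto simp: functional_fixing_group_def invertible_mult matrix_vector_mul_assoc[symmetric]
    invertible_def[of "mat 1"] intro: exI[of _ "mat 1"])

text \<open>
  The group is the kernel of the character that sends \<open>A\<close> to its factor \<open>c\<close>.
\<close>

lemma normal_functional_fixing_group:
  "functional_fixing_group w \<lhd> GL\<lparr>carrier := units_of_subalgebra (hyperplane_algebra w)\<rparr>"
proof -
  let ?G = "units_of_subalgebra (hyperplane_algebra w)"
  have G: "subgroup ?G GL"
    by (rule subgroup_units_of_subalgebra[OF matrix_subalgebra_hyperplane_algebra])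
  have "functional_fixing_group w \<subseteq> ?G"
    by (auto simp: functional_fixing_group_def units_of_subalgebra_def hyperplane_algebra_def
        intro: exI[of _ 1])
  then have "subgroup (functional_fixing_group w) (GL\<lparr>carrier := ?G\<rparr>)"
    by (rule group.subgroup_incl[OF group_GL subgroup_functional_fixing_group G])
  moreover have "A ** B ** matrix_inv A \<in> functional_fixing_group w"
    if A: "A \<in> ?G" and B: "B \<in> functional_fixing_group w" for A B
  proof -
    obtain c where c: "invertible A" "\<And>x. w \<bullet> (A *v x) = c * (w \<bullet> x)"
      using A by (auto simp: units_of_subalgebra_def hyperplane_algebra_def)
    have "w \<bullet> ((A ** B ** matrix_inv A) *v x) = w \<bullet> x" for x
      using B matrix_inv_functional[OF c, of x]
      by (simp add: matrix_vector_mul_assoc[symmetric] c(2) functional_fixing_group_def)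
    then show ?thesis
      using B c(1) by (simp add: functional_fixing_group_def invertible_mult invertible_matrix_inv)
  qed
  moreover have "m_inv (GL\<lparr>carrier := ?G\<rparr>) A = matrix_inv A" if "A \<in> ?G" for A
    using group.m_inv_consistent[OF group_GL G that] m_inv_GL[of A] that
    by (simp add: units_of_subalgebra_def)
  ultimately show ?thesis
    by (simp add: group.normal_inv_iff[OF subgroup.subgroup_is_group[OF G group_GL]])
qed

lemma lie_group_functional_fixing_group:
  "lie_group (dim (annihilated_by w)) (GL\<lparr>carrier := functional_fixing_group w\<rparr>)"
  by (rule lie_group_affine_subgroup_GL[OF subgroup_functional_fixing_group subspace_annihilated_by
        functional_fixing_group_eq])

definition outer_product :: "real^'m \<Rightarrow> real^'n \<Rightarrow> real^'n^'m" where
  "outer_product a b = (\<chi> i j. a $ i * b $ j)"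

lemma outer_product_vector: "outer_product a b *v x = (b \<bullet> x) *\<^sub>R a"
  by (simp add: outer_product_def matrix_vector_mult_def vec_eq_iff inner_vec_def sum_distrib_left
      sum_distrib_right mult_ac)

text \<open>
  Here \<open>J\<close> parametrizes the hyperplane normal to the unit vector \<open>w\<close>, and \<open>K\<close> is the projection
  along \<open>w\<close> followed by the inverse of the parametrization. In the resulting coordinates the matrix
  has the rows \<open>(A, b)\<close> and \<open>(0, 1)\<close>.
\<close>

definition affine_to_linear ::
    "real^'m^'n \<Rightarrow> real^'n^'m \<Rightarrow> real^'n \<Rightarrow> (real^'m^'m) \<times> (real^'m) \<Rightarrow> real^'n^'n" where
  "affine_to_linear J K w z = J ** fst z ** K + outer_product (J *v snd z + w) w"

definition linear_to_affine ::
    "real^'m^'n \<Rightarrow> real^'n^'m \<Rightarrow> real^'n \<Rightarrow> real^'n^'n \<Rightarrow> (real^'m^'m) \<times> (real^'m)" where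
  "linear_to_affine J K w X = (K ** X ** J, (K ** X) *v w)"

lemma affine_to_linear_vector:
  "affine_to_linear J K w (A, b) *v x = J *v (A *v (K *v x)) + (w \<bullet> x) *\<^sub>R (J *v b + w)"
  by (simp add: affine_to_linear_def matrix_vector_mult_add_rdistrib outer_product_vector
      matrix_vector_mul_assoc[symmetric])

text \<open>
  The maps \<open>affine_to_linear\<close> and \<open>linear_to_affine\<close> are mutually inverse and both are restrictions
  of affine maps between the ambient matrix spaces, hence smooth.
\<close>

theorem Aff_isomorphic_functional_fixing_group:
  fixes J :: "real^'m^'n" and K :: "real^'n^'m"
  assumes w: "w \<bullet> w = 1"
    and KJ: "\<And>x. K *v (J *v x) = x" and JK: "\<And>y. J *v (K *v y) = y - (w \<bullet> y) *\<^sub>R w"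
  shows "lie_group_isomorphic (Aff :: ((real^'m^'m) \<times> (real^'m)) monoid)
    (GL\<lparr>carrier := functional_fixing_group w\<rparr>)"
proof -
  let ?F = "affine_to_linear J K w" and ?G = "linear_to_affine J K w"
  let ?N = "functional_fixing_group w"
  have wJ: "w \<bullet> (J *v x) = 0" for x
  proof -
    have "w \<bullet> (J *v (K *v (J *v x))) = 0" unfolding JK by (simp add: inner_diff_right w)
    then show ?thesis by (simp add: KJ)
  qed
  have Kw: "K *v w = 0"
    using KJ[of "K *v w"] by (simp add: JK w matrix_vector_mult_0_right)
  note act = affine_to_linear_vector matrix_vector_mul_assoc[symmetric] matrix_vector_right_distrib
    matrix_vector_mult_diff_distrib matrix_vector_mult_scaleR
  have hom: "?F (A ** C, A *v d + b) = ?F (A, b) ** ?F (C, d)" for A b C d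
    by (rule matrix_eq[THEN iffD2]) (simp add: act KJ Kw wJ w inner_add_right algebra_simps)
  have F1: "?F (mat 1, 0) = mat 1"
    by (rule matrix_eq[THEN iffD2]) (simp add: act JK)
  have F: "?F (A, b) \<in> ?N" if A: "invertible A" for A b
  proof -
    have AA: "A ** matrix_inv A = mat 1" using A by (simp add: matrix_inv_mult)
    then have XX: "A *v (matrix_inv A *v x) = x" for x
      by (simp add: matrix_vector_mul_assoc)
    have "?F (A, b) ** ?F (matrix_inv A, matrix_inv A *v (- b)) = mat 1"
      using A by (simp add: hom[symmetric] act XX F1 AA)
    then have "invertible (?F (A, b))" using invertible_right_inverse by blast
    then show ?thesis
      by (simp add: functional_fixing_group_def act inner_add_right wJ w)
  qed
  have GF: "?G (?F z) = z" for z
    by (cases z, simp add: linear_to_affine_def, intro conjI matrix_eq[THEN iffD2] allI)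
      (simp_all add: act KJ Kw wJ w)
  have FG: "?F (?G X) = X" if X: "X \<in> ?N" for X
    using X unfolding linear_to_affine_def functional_fixing_group_def
    by (intro matrix_eq[THEN iffD2] allI) (simp add: act JK inner_diff_right w algebra_simps)
  have G: "?G X \<in> carrier Aff" if X: "X \<in> ?N" for X
  proof -
    have inv: "invertible X" and wX: "\<And>x. w \<bullet> (X *v x) = w \<bullet> x"
      using X by (auto simp: functional_fixing_group_def)
    have wX': "w \<bullet> (matrix_inv X *v x) = w \<bullet> x" for x
      using matrix_inv_functional[of X w 1] inv wX by simp
    have XX: "X *v (matrix_inv X *v x) = x" for x
      using inv by (simp add: matrix_vector_mul_assoc matrix_inv_mult)
    have "(K ** X ** J) ** (K ** matrix_inv X ** J) = mat 1"
      by (rule matrix_eq[THEN iffD2]) (simp add: act JK wX' wJ XX KJ)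
    then have "invertible (K ** X ** J)" using invertible_right_inverse by blast
    then show ?thesis by (simp add: Aff_def linear_to_affine_def)
  qed
  have car: "carrier Aff = {z :: (real^'m^'m) \<times> (real^'m). invertible (fst z)}"
    by (auto simp: Aff_def)
  have bij: "bij_betw ?F (carrier Aff) ?N"
    by (rule bij_betw_byWitness[of _ ?G]) (use F G FG GF in \<open>auto simp: car\<close>)
  have "?F \<in> iso Aff (GL\<lparr>carrier := ?N\<rparr>)"
    unfolding iso_def hom_def using bij F by (auto simp: Aff_def hom)
  moreover have "smooth_map_on (carrier Aff) ?F"
  proof (rule smooth_map_onI)
    let ?L = "\<lambda>z. J ** fst z ** K + outer_product (J *v snd z) w"
    have "linear ?L"
      by (rule linearI; rule matrix_eq[THEN iffD2])
        (simp_all add: act matrix_vector_mult_add_rdistrib outer_product_vector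
          scaleR_matrix_vector_assoc[symmetric] algebra_simps)
    then show "smooth_on UNIV (\<lambda>z. ?L z + outer_product w w)"
      by (intro smooth_on_affine) (auto simp: linear_conv_bounded_linear)
    show "?L z + outer_product w w = ?F z" for z
      by (rule matrix_eq[THEN iffD2])
        (simp add: affine_to_linear_def matrix_vector_mult_add_rdistrib outer_product_vector algebra_simps)
  qed simp
  moreover have "smooth_map_on ?N (inv_into (carrier Aff) ?F)"
  proof (rule smooth_map_onI)
    have "linear ?G"
      unfolding linear_to_affine_def
      by (rule linearI)
        (simp_all add: matrix_add_ldistrib matrix_mult_add_rdistrib matrix_vector_mult_add_rdistrib
          matrix_scalar_ac scalar_matrix_assoc scaleR_matrix_vector_assoc)
    then show "smooth_on UNIV (\<lambda>X. ?G X + 0)"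
      by (intro smooth_on_affine) (auto simp: linear_conv_bounded_linear)
    show "?G X + 0 = inv_into (carrier Aff) ?F X" if "X \<in> ?N" for X
      using bij_betw_imp_inj_on[OF bij] G[OF that] FG[OF that] by (simp add: inv_into_f_eq)
  qed simp
  ultimately show ?thesis
    unfolding lie_group_isomorphic_def by (intro exI[of _ ?F]) simp
qed

text \<open>
  An isometry between \<open>\<real>\<^sup>m\<close> and the hyperplane, which have the same dimension.
\<close>

lemma hyperplane_coordinates:
  fixes w :: "real^'n"
  assumes w: "w \<bullet> w = 1" and card: "CARD('m::finite) = CARD('n) - 1"
  obtains J :: "real^'m^'n" and K :: "real^'n^'m"
  where "\<And>x. K *v (J *v x) = x" "\<And>y. J *v (K *v y) = y - (w \<bullet> y) *\<^sub>R w"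
proof -
  let ?H = "{x. w \<bullet> x = 0}"
  have "w \<noteq> 0" using w by auto
  then have "dim (UNIV :: (real^'m) set) = dim ?H"
    using card by (simp add: dim_hyperplane)
  then obtain f :: "real^'m \<Rightarrow> real^'n" and g where fg: "linear f" "linear g" "f ` UNIV = ?H"
    "\<And>x. x \<in> UNIV \<Longrightarrow> g (f x) = x" "\<And>y. y \<in> ?H \<Longrightarrow> f (g y) = y"
    by (blast intro: isometries_subspaces[OF subspace_UNIV subspace_hyperplane[of w]])
  let ?p = "\<lambda>y. y - (w \<bullet> y) *\<^sub>R w"
  have p: "linear ?p"
    by (rule linearI) (simp_all add: inner_add_right algebra_simps)
  then have gp: "linear (\<lambda>y. g (?p y))" using linear_compose[OF _ fg(2)] by (simp add: comp_def)
  have mat: "matrix (\<lambda>y. g (?p y)) *v y = g (?p y)" "matrix f *v x = f x" for x y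
    using gp fg(1) by (simp_all add: matrix_works linear_matrix_vector_mul_eq)
  show thesis
  proof (rule that[of "matrix (\<lambda>y. g (?p y))" "matrix f"])
    show "matrix (\<lambda>y. g (?p y)) *v (matrix f *v x) = x" for x
    proof -
      have "w \<bullet> f x = 0" using fg(3) by blast
      then show ?thesis by (simp add: mat fg(4))
    qed
    show "matrix f *v (matrix (\<lambda>y. g (?p y)) *v y) = ?p y" for y
      unfolding mat by (rule fg(5)) (simp add: inner_diff_right w)
  qed
qed

theorem corollary2:
  assumes "CARD('n::finite) \<ge> 2"
  shows
    "(\<forall>H :: (real^'n) set. linear_hyperplane H \<longrightarrow>
        subgroup (hyperplane_stabilizer H) GL \<and>
        contact_lie_group (GL\<lparr>carrier := hyperplane_stabilizer H\<rparr>) \<and>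
        (CARD('m::finite) = CARD('n) - 1 \<longrightarrow>
          (\<exists>N d. N \<lhd> GL\<lparr>carrier := hyperplane_stabilizer H\<rparr> \<and>
             lie_group d (GL\<lparr>carrier := N\<rparr>) \<and>
             lie_group (d + 1) (GL\<lparr>carrier := hyperplane_stabilizer H\<rparr>) \<and>
             lie_group_isomorphic (Aff :: ((real^'m^'m) \<times> (real^'m)) monoid) (GL\<lparr>carrier := N\<rparr>))))
     \<and>
     (\<forall>v :: real^'n. v \<noteq> 0 \<longrightarrow>
        subgroup (eigenvector_subgroup v) GL \<and>
        contact_lie_group (GL\<lparr>carrier := eigenvector_subgroup v\<rparr>))"
proof (intro conjI allI impI)
  fix H :: "(real^'n) set"
  assume "linear_hyperplane H"
  then obtain w where w: "w \<bullet> w = 1" "H = {x. w \<bullet> x = 0}"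
    by (rule linear_hyperplane_unit_normal)
  note H = hyperplane_stabilizer_eq[OF w(1), folded w(2)]
  show "subgroup (hyperplane_stabilizer H) GL"
    unfolding H by (rule subgroup_units_of_subalgebra[OF matrix_subalgebra_hyperplane_algebra])
  have "w \<noteq> 0" using w(1) by auto
  then show "contact_lie_group (GL\<lparr>carrier := hyperplane_stabilizer H\<rparr>)"
    unfolding H by (rule contact_lie_group_hyperplane_algebra)
  assume "CARD('m::finite) = CARD('n) - 1"
  then obtain J :: "real^'m^'n" and K :: "real^'n^'m"
    where JK: "\<And>x. K *v (J *v x) = x" "\<And>y. J *v (K *v y) = y - (w \<bullet> y) *\<^sub>R w"
    using hyperplane_coordinates[OF w(1)] by metis
  have "lie_group (dim (annihilated_by w) + 1) (GL\<lparr>carrier := hyperplane_stabilizer H\<rparr>)"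
    unfolding H dim_hyperplane_algebra[OF w(1), symmetric]
    by (rule lie_group_units_of_subalgebra[OF matrix_subalgebra_hyperplane_algebra])
  moreover have "functional_fixing_group w \<lhd> GL\<lparr>carrier := hyperplane_stabilizer H\<rparr>"
    unfolding H by (rule normal_functional_fixing_group)
  ultimately show "\<exists>N d. N \<lhd> GL\<lparr>carrier := hyperplane_stabilizer H\<rparr> \<and>
      lie_group d (GL\<lparr>carrier := N\<rparr>) \<and>
      lie_group (d + 1) (GL\<lparr>carrier := hyperplane_stabilizer H\<rparr>) \<and>
      lie_group_isomorphic (Aff :: ((real^'m^'m) \<times> (real^'m)) monoid) (GL\<lparr>carrier := N\<rparr>)"
    using lie_group_functional_fixing_group Aff_isomorphic_functional_fixing_group[OF w(1) JK] by blast
next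
  fix v :: "real^'n"
  assume "v \<noteq> 0"
  then show "contact_lie_group (GL\<lparr>carrier := eigenvector_subgroup v\<rparr>)"
    by (rule contact_lie_group_eigenvector_subgroup)
  show "subgroup (eigenvector_subgroup v) GL"
    unfolding eigenvector_subgroup_eq
    by (rule subgroup_units_of_subalgebra[OF matrix_subalgebra_eigenvector_algebra])
qed

end
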